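(* For every $d\in(0,1)$ and every $p\in(1-d,1)$, there exist a regular Cantor set $K\subset\mathbb R$ of Hausdorff dimension $d$ and a Cantor set $\tilde K\subset\mathbb R$ of positive Lebesgue measure satisfying condition $(\mathcal C_p)$ such that for every $\lambda>0$ and every $t\in\mathbb R$, the set $\lambda K+t$ is not included in $\tilde K$.
   Context: Condition $(\mathcal C_p)$, $0<p<1$: a compact set $\tilde K\subset\mathbb R$ with convex hull $[a,a+\operatorname{diam}\tilde K]$, whose complementary components in the hull are the open intervals $(a_n,b_n)$, satisfies $(\mathcal C_p)$ if $\sum_n (b_n-a_n)^p<\infty$. Regular Cantor set: a Cantor set $K\subset\mathbb R$ is $C^k$-regular ($k\ge1$) if (i) there are disjoint compact intervals $I_1,\dots,I_r$ such that $K\subset I_1\cup\dots\cup I_r$ and the boundary of each $I_j$ is contained in $K$; (ii) there is a $C^k$ expanding map $\psi$ defined in a neighbourhood of $I_1\cup\dots\cup I_r$ such that each $\psi(I_j)$ is the convex hull of a finite union of some of the intervals $I_s$, for each $j$ and all sufficiently large $n$ one has $\psi^n(K\cap I_j)=K$, and $K=\bigcap_{n\in\mathbb N}\psi^{-n}(I_1\cup\dots\cup I_r)$. "Regular" means $C^k$-regular for some $k\ge 1$ (for regular Cantor sets of class $C^{1+\alpha}$, Hausdorff and box dimensions coincide). *)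

theory Defs
  imports "HOL-Analysis.Analysis"
begin

(* Covering sets must be bounded, since diameter is unspecified on unbounded sets. *)
definition hausdorff_premeasure :: "real \<Rightarrow> real \<Rightarrow> 'a::metric_space set \<Rightarrow> ennreal" where
  "hausdorff_premeasure s \<delta> A =
     (INF U \<in> {U :: nat \<Rightarrow> 'a set. A \<subseteq> (\<Union>i. U i) \<and> (\<forall>i. bounded (U i) \<and> diameter (U i) \<le> \<delta>)}.
        \<Sum>i. ennreal (diameter (U i) powr s))"

definition hausdorff_measure :: "real \<Rightarrow> 'a::metric_space set \<Rightarrow> ennreal" where
  "hausdorff_measure s A = (SUP \<delta> \<in> {0<..}. hausdorff_premeasure s \<delta> A)"

(* Only exponents s > 0 are used: as 0 powr 0 = 0, hausdorff_measure 0 is not the counting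
   measure. The exponent 0 does not affect the infimum. *)
definition hausdorff_dim :: "'a::metric_space set \<Rightarrow> ennreal" where
  "hausdorff_dim A = Inf {ennreal s | s. 0 < s \<and> hausdorff_measure s A = 0}"

definition cantor_set :: "real set \<Rightarrow> bool" where
  "cantor_set K \<longleftrightarrow>
     K \<noteq> {} \<and> compact K \<and> (\<forall>x\<in>K. x islimpt K) \<and>
     (\<forall>x\<in>K. connected_component_set K x = {x})"

(* Intended for open N, where deriv at a point of N depends only on f restricted to N. *)
definition C_k_on :: "nat \<Rightarrow> (real \<Rightarrow> real) \<Rightarrow> real set \<Rightarrow> bool" where
  "C_k_on k f N \<longleftrightarrow>
     (\<forall>i<k. \<forall>x\<in>N. (deriv ^^ i) f differentiable (at x)) \<and>
     continuous_on N ((deriv ^^ k) f)"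

definition expanding_on :: "(real \<Rightarrow> real) \<Rightarrow> real set \<Rightarrow> bool" where
  "expanding_on f N \<longleftrightarrow> (\<exists>c>1. \<forall>x\<in>N. c \<le> \<bar>deriv f x\<bar>)"

(* The map psi is a total function, but only its values on the open neighbourhood N matter.
   The intersection of the preimages includes n = 0, so it consists of the points whose whole
   forward orbit stays in the union of the intervals, hence in N. *)
definition C_k_regular_cantor_set :: "nat \<Rightarrow> real set \<Rightarrow> bool" where
  "C_k_regular_cantor_set k K \<longleftrightarrow>
     cantor_set K \<and>
     (\<exists>(r::nat) (I :: nat \<Rightarrow> real set) N \<psi>.
        (\<forall>j\<in>{1..r}. \<exists>a b. a < b \<and> I j = {a..b}) \<and>
        disjoint_family_on I {1..r} \<and>
        K \<subseteq> (\<Union>j\<in>{1..r}. I j) \<and>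
        (\<forall>j\<in>{1..r}. frontier (I j) \<subseteq> K) \<and>
        open N \<and> (\<Union>j\<in>{1..r}. I j) \<subseteq> N \<and>
        C_k_on k \<psi> N \<and> expanding_on \<psi> N \<and>
        (\<forall>j\<in>{1..r}. \<exists>S\<subseteq>{1..r}. \<psi> ` I j = convex hull (\<Union>s\<in>S. I s)) \<and>
        (\<forall>j\<in>{1..r}. \<forall>\<^sub>F n in sequentially. (\<psi> ^^ n) ` (K \<inter> I j) = K) \<and>
        K = (\<Inter>n. (\<psi> ^^ n) -` (\<Union>j\<in>{1..r}. I j)))"

definition regular_cantor_set :: "real set \<Rightarrow> bool" where
  "regular_cantor_set K \<longleftrightarrow> (\<exists>k\<ge>1. C_k_regular_cantor_set k K)"

definition gaps :: "real set \<Rightarrow> (real \<times> real) set" where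
  "gaps K = {(a, b). a < b \<and> {a<..<b} \<in> components (convex hull K - K)}"

definition gap_condition :: "real \<Rightarrow> real set \<Rightarrow> bool" where
  "gap_condition p K \<longleftrightarrow> compact K \<and> (\<lambda>(a, b). (b - a) powr p) summable_on gaps K"

end

theory Submission
  imports Defs
begin

text \<open>
  Take for \<open>K\<close> the middle Cantor set of ratio \<open>\<rho>\<close> with \<open>2 \<rho>^d = 1\<close>. An interval of length \<open>\<epsilon>\<close>
  placed uniformly at random meets a given copy \<open>\<lambda> K + t\<close> of size about 1 with probability at
  least of order \<open>\<epsilon>^(1-d)\<close>. There are only about \<open>\<epsilon>^(-2)\<close> pairs \<open>(\<lambda>, t)\<close> to distinguish at scale
  \<open>\<epsilon>\<close>, so about \<open>\<epsilon>^(-(1-d)) log (1/\<epsilon>)\<close> intervals suffice to meet all of these copies, and the sum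
  of the \<open>p\<close>-th powers of their lengths tends to 0 with \<open>\<epsilon>\<close> because \<open>p > 1 - d\<close>. Doing this for
  \<open>\<lambda> \<in> [1/m, 1]\<close>, for each \<open>m\<close> with \<open>\<epsilon>\<close> small enough, and deleting all intervals from \<open>[0, 1]\<close> leaves
  a closed set of positive measure without copies of \<open>K\<close>. The support of
  Lebesgue measure on this set is perfect, and a gap of that support is filled up to measure
  zero by deleted intervals, no two gaps sharing one, so that subadditivity of \<open>x \<mapsto> x^p\<close> bounds the gap sum.
\<close>

section \<open>A criterion for Cantor sets, and the greedy choice of points\<close>

text \<open>A connected subset of the line with two distinct points contains the whole segment
  between them, so components are singletons as soon as no nondegenerate interval fits into
  \<open>K\<close>.\<close>

lemma cantor_setI:
  assumes "K \<noteq> {}" "compact K" "\<And>x. x \<in> K \<Longrightarrow> x islimpt K"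
    and no_interval: "\<And>a b. a < b \<Longrightarrow> \<not> {a..b} \<subseteq> K"
  shows "cantor_set K"
proof -
  have "connected_component_set K x = {x}" if x: "x \<in> K" for x
  proof -
    have "y = z" if "connected T" "T \<subseteq> K" "y \<in> T" "z \<in> T" "y \<le> z" for T y z
    proof (rule ccontr)
      assume "y \<noteq> z"
      then have "y < z" using that by simp
      moreover have "{y..z} \<subseteq> K"
        using that connected_contains_Icc[of T y z] by blast
      ultimately show False using no_interval by blast
    qed
    then have "connected_component K x y \<Longrightarrow> y = x" for y
      unfolding connected_component_def by (metis linear)
    then show ?thesis using connected_component_refl[OF x] by auto
  qed
  then show ?thesis unfolding cantor_set_def using assms(1-3) by blast
qed

text \<open>Greedy choice: by double counting, some \<open>b\<close> lies in \<open>G a\<close> for a proportion \<open>\<beta>\<close> of the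
  remaining \<open>a\<close>.\<close>
lemma hitting_sequence:
  fixes \<beta> :: real
  assumes "finite A" "finite B" "B \<noteq> {}" "\<beta> \<le> 1"
    and "\<And>a. a \<in> A \<Longrightarrow> G a \<subseteq> B \<and> \<beta> * card B \<le> card (G a)"
    and "card A * (1 - \<beta>) ^ N < 1"
  shows "\<exists>x. \<forall>a\<in>A. \<exists>k<N. x k \<in> G a"
  using assms(1,5,6)
proof (induction N arbitrary: A)
  case 0
  then show ?case by simp
next
  case (Suc N)
  show ?case
  proof (cases "A = {}")
    case False
    have "\<exists>b\<in>B. \<beta> * card A \<le> card {a\<in>A. b \<in> G a}"
    proof (rule ccontr)
      assume "\<not> ?thesis"
      then have "(\<Sum>b\<in>B. real (card {a\<in>A. b \<in> G a})) < (\<Sum>b\<in>B. \<beta> * card A)"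
        using assms(2,3) by (intro sum_strict_mono) auto
      also have "\<dots> = (\<Sum>a\<in>A. \<beta> * card B)" by simp
      also have "\<dots> \<le> (\<Sum>a\<in>A. real (card (G a)))" using Suc.prems by (intro sum_mono) auto
      also have "\<dots> = (\<Sum>a\<in>A. \<Sum>b\<in>B. of_bool (b \<in> G a))"
      proof (intro sum.cong refl)
        fix a assume "a \<in> A"
        then have "B \<inter> {b. b \<in> G a} = G a" using Suc.prems(2) by blast
        then show "real (card (G a)) = (\<Sum>b\<in>B. of_bool (b \<in> G a))"
          using assms(2) by (simp add: sum_of_bool_eq)
      qed
      also have "\<dots> = (\<Sum>b\<in>B. \<Sum>a\<in>A. of_bool (b \<in> G a))" by (rule sum.swap)
      also have "\<dots> = (\<Sum>b\<in>B. real (card {a\<in>A. b \<in> G a}))"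
        using Suc.prems(1) by (intro sum.cong refl) (simp add: sum_of_bool_eq Collect_conj_eq)
      finally show False by simp
    qed
    then obtain b where b: "\<beta> * card A \<le> card {a\<in>A. b \<in> G a}" by blast
    let ?A = "{a\<in>A. b \<notin> G a}"
    have "card A = card {a\<in>A. b \<in> G a} + card ?A"
      using Suc.prems(1) by (subst card_Un_disjoint[symmetric]) (auto intro: arg_cong[where f=card])
    then have "real (card ?A) \<le> card A * (1 - \<beta>)" using b by (simp add: algebra_simps)
    then have "card ?A * (1 - \<beta>) ^ N \<le> card A * (1 - \<beta>) * (1 - \<beta>) ^ N"
      using assms(4) by (intro mult_right_mono) auto
    then have "card ?A * (1 - \<beta>) ^ N < 1" using Suc.prems(3) by (simp add: mult.assoc)
    then obtain x where x: "\<forall>a\<in>?A. \<exists>k<N. x k \<in> G a"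
      using Suc.IH[of ?A] Suc.prems by auto
    have "\<exists>k<Suc N. case_nat b x k \<in> G a" if "a \<in> A" for a
    proof (cases "b \<in> G a")
      case True
      then show ?thesis by (intro exI[of _ 0]) simp
    next
      case False
      then have "a \<in> ?A" using that by simp
      then obtain k where "k < N" "x k \<in> G a" using bspec[OF x] by metis
      then show ?thesis by (intro exI[of _ "Suc k"]) simp
    qed
    then show ?thesis by blast
  qed simp
qed

subsection \<open>Middle Cantor sets\<close>

locale cantor_ratio =
  fixes \<rho> :: real
  assumes \<rho>_pos: "0 < \<rho>" and \<rho>_less: "\<rho> < 1/2"
begin

text \<open>The two branches of the iterated function system with attractor \<open>C\<close>,
  indexed by a boolean so that arguments by branch stay uniform; \<open>False\<close> is the left
  one.\<close>

definition contr :: "bool \<Rightarrow> real \<Rightarrow> real" where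
  "contr b x = (if b then \<rho> * x + (1 - \<rho>) else \<rho> * x)"

text \<open>The common inverse of both branches. The cut at 1/2 lies in the middle gap, so the map
  is affine near each of the two first-level intervals.\<close>

definition expand :: "real \<Rightarrow> real" where
  "expand x = (if x < 1/2 then x / \<rho> else (x - (1 - \<rho>)) / \<rho>)"

fun stage :: "nat \<Rightarrow> real set" where
  "stage 0 = {0..1}"
| "stage (Suc n) = contr False ` stage n \<union> contr True ` stage n"

definition C :: "real set" where
  "C = (\<Inter>n. stage n)"

lemma contr_unit: "0 \<le> x \<Longrightarrow> x \<le> 1 \<Longrightarrow> contr b x \<in> {0..\<rho>} \<union> {1-\<rho>..1}"
  using \<rho>_pos \<rho>_less by (auto simp: contr_def mult_le_cancel_left1)

lemma expand_contr:
  assumes "0 \<le> x" "x \<le> 1"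
  shows "expand (contr b x) = x"
proof -
  have "\<rho> * x \<le> \<rho>" "0 \<le> \<rho> * x"
    using assms \<rho>_pos by (simp_all add: mult_left_le)
  then have "contr b x < 1/2 \<longleftrightarrow> \<not> b" using \<rho>_less by (simp add: contr_def)
  then show ?thesis using \<rho>_pos by (simp add: contr_def expand_def)
qed

lemma contr_diff: "contr b x - contr b y = \<rho> * (x - y)"
  by (simp add: contr_def algebra_simps)

lemma contr_branches:
  assumes "0 \<le> x" "x \<le> 1" "0 \<le> y" "y \<le> 1"
  shows "1 - 2 * \<rho> \<le> contr True x - contr False y"
proof -
  have "\<rho> * y \<le> \<rho>" "0 \<le> \<rho> * x"
    using assms \<rho>_pos by (simp_all add: mult_left_le)
  then show ?thesis by (simp add: contr_def)
qed

lemma stage_unit: "stage n \<subseteq> {0..1}"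
proof (induction n)
  case (Suc n)
  have "contr b x \<in> {0..1}" if "x \<in> stage n" for b x
  proof -
    have "0 \<le> x" "x \<le> 1" using Suc that by auto
    then show ?thesis using contr_unit[of x b] \<rho>_pos \<rho>_less by auto
  qed
  then show ?case by auto
qed simp

lemma C_unit: "C \<subseteq> {0..1}"
  unfolding C_def using stage.simps(1) by blast

lemma stage_Suc_iff:
  "x \<in> stage (Suc n) \<longleftrightarrow> x \<in> {0..\<rho>} \<union> {1-\<rho>..1} \<and> expand x \<in> stage n"
proof
  assume "x \<in> stage (Suc n)"
  then obtain b y where y: "y \<in> stage n" "x = contr b y" by auto
  moreover have "0 \<le> y" "y \<le> 1" using y stage_unit[of n] by auto
  ultimately show "x \<in> {0..\<rho>} \<union> {1-\<rho>..1} \<and> expand x \<in> stage n"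
    using contr_unit[of y b] expand_contr[of y b] by simp
next
  assume x: "x \<in> {0..\<rho>} \<union> {1-\<rho>..1} \<and> expand x \<in> stage n"
  have "x = contr (\<not> x < 1/2) (expand x)"
    using \<rho>_pos by (simp add: contr_def expand_def)
  then show "x \<in> stage (Suc n)" using x by (cases "x < 1/2") auto
qed

text \<open>Self-similarity of \<open>C\<close> in pulled-back form, obtained by intersecting
  \<open>stage_Suc_iff\<close> over all levels.\<close>

lemma C_iff: "x \<in> C \<longleftrightarrow> x \<in> {0..\<rho>} \<union> {1-\<rho>..1} \<and> expand x \<in> C"
proof
  assume x: "x \<in> C"
  then have "x \<in> stage (Suc n)" for n unfolding C_def by blast
  then show "x \<in> {0..\<rho>} \<union> {1-\<rho>..1} \<and> expand x \<in> C"
    unfolding stage_Suc_iff C_def by blast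
next
  assume x: "x \<in> {0..\<rho>} \<union> {1-\<rho>..1} \<and> expand x \<in> C"
  have "x \<in> stage n" for n
  proof (cases n)
    case 0
    then show ?thesis using x \<rho>_pos \<rho>_less by auto
  next
    case (Suc m)
    then show ?thesis using x stage_Suc_iff C_def by blast
  qed
  then show "x \<in> C" unfolding C_def by blast
qed

lemma contr_C: "x \<in> C \<Longrightarrow> contr b x \<in> C"
  using C_unit contr_unit[of x b] expand_contr[of x b] C_iff[of "contr b x"] by auto

lemma C_cases:
  assumes "x \<in> C"
  obtains b y where "y \<in> C" "x = contr b y"
proof -
  have "x = contr (\<not> x < 1/2) (expand x)"
    using \<rho>_pos by (simp add: contr_def expand_def)
  then show ?thesis using that assms C_iff by blast
qed

lemma zero_in_C: "0 \<in> C" and one_in_C: "1 \<in> C"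
proof -
  have "0 \<in> stage n \<and> 1 \<in> stage n" for n
  proof (induction n)
    case (Suc n)
    have "0 = contr False 0" "1 = contr True 1" by (simp_all add: contr_def)
    then show ?case using Suc by (metis UnI1 UnI2 image_eqI stage.simps(2))
  qed simp
  then show "0 \<in> C" "1 \<in> C" unfolding C_def by auto
qed

lemma compact_C: "compact C"
proof -
  have "compact (stage n)" for n
  proof (induction n)
    case (Suc n)
    have "continuous_on A (contr b)" for A b
      unfolding contr_def by (cases b) (auto intro!: continuous_intros)
    then show ?case using Suc by (auto intro!: compact_Un compact_continuous_image)
  qed simp
  then show ?thesis unfolding C_def by (intro compact_Inter) auto
qed

text \<open>At level 0 one of the points 0 and 1 differs from \<open>x\<close>; each application of
  a branch shrinks the distance to the second point by the factor \<open>\<rho>\<close>.\<close>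

lemma C_perfect:
  assumes "x \<in> C" shows "x islimpt C"
proof -
  have approx: "\<exists>y\<in>C. y \<noteq> x \<and> \<bar>y - x\<bar> \<le> \<rho> ^ n" if "x \<in> C" for n x
    using that
  proof (induction n arbitrary: x)
    case 0
    have "\<bar>0 - x\<bar> \<le> 1" "\<bar>1 - x\<bar> \<le> 1" using 0 C_unit by auto
    then show ?case using zero_in_C one_in_C by (metis power_0 zero_neq_one)
  next
    case (Suc n)
    obtain b z where z: "z \<in> C" "x = contr b z" using C_cases Suc.prems by blast
    obtain y where y: "y \<in> C" "y \<noteq> z" "\<bar>y - z\<bar> \<le> \<rho> ^ n" using Suc.IH z by blast
    have "contr b y - x = \<rho> * (y - z)" using z contr_diff by simp
    moreover have "\<bar>\<rho> * (y - z)\<bar> \<le> \<rho> ^ Suc n" "\<rho> * (y - z) \<noteq> 0"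
      using y \<rho>_pos by (auto simp: abs_mult)
    ultimately show ?case using contr_C[OF y(1), of b] by (metis right_minus_eq)
  qed
  show ?thesis unfolding islimpt_approachable
  proof (intro allI impI)
    fix e :: real assume "0 < e"
    obtain n where "\<rho> ^ n < e"
      using real_arch_pow_inv[OF \<open>0 < e\<close>, of \<rho>] \<rho>_less by auto
    moreover obtain y where "y \<in> C" "y \<noteq> x" "\<bar>y - x\<bar> \<le> \<rho> ^ n"
      using approx[OF assms] by blast
    ultimately show "\<exists>y\<in>C. y \<noteq> x \<and> dist y x < e"
      unfolding dist_real_def by (meson le_less_trans)
  qed
qed

text \<open>Such an interval lies in a single branch, and \<open>expand\<close> stretches it by
  \<open>1 / \<rho>\<close> onto an interval inside the previous stage.\<close>

lemma stage_interval_length: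
  "x \<le> y \<Longrightarrow> {x..y} \<subseteq> stage n \<Longrightarrow> y - x \<le> \<rho> ^ n"
proof (induction n arbitrary: x y)
  case (Suc n)
  have sub: "z \<in> {0..\<rho>} \<union> {1-\<rho>..1} \<and> expand z \<in> stage n" if "z \<in> {x..y}" for z
    using Suc.prems that stage_Suc_iff by blast
  \<comment> \<open>Otherwise the interval would contain 1/2, which lies in the removed middle
    gap.\<close>
  have same: "x < 1/2 \<longleftrightarrow> y < 1/2"
    using sub[of "1/2"] Suc.prems(1) \<rho>_less by force
  define b where "b = (\<not> x < 1/2)"
  have inv: "z = contr b (expand z)" if "z \<in> {x..y}" for z
    using that same \<rho>_pos by (auto simp: b_def contr_def expand_def)
  have len: "y - x = \<rho> * (expand y - expand x)"
    using inv[of x] inv[of y] Suc.prems(1) contr_diff[of b "expand y" "expand x"] by simp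
  have "{expand x..expand y} \<subseteq> stage n"
  proof
    fix w assume w: "w \<in> {expand x..expand y}"
    have "contr b (expand x) \<le> contr b w" "contr b w \<le> contr b (expand y)"
      using w \<rho>_pos by (auto simp: contr_def)
    then have "contr b w \<in> {x..y}" using inv[of x] inv[of y] Suc.prems(1) by auto
    moreover have "expand (contr b w) = w"
      using expand_contr[of w b] w sub[of x] sub[of y] Suc.prems(1) stage_unit[of n] by force
    ultimately show "w \<in> stage n" using sub by force
  qed
  moreover have "expand x \<le> expand y" using len Suc.prems(1) \<rho>_pos
    by (metis diff_ge_0_iff_ge zero_le_mult_iff less_le_not_le)
  ultimately have "expand y - expand x \<le> \<rho> ^ n" by (rule Suc.IH[rotated])
  then show ?case using len \<rho>_pos by simp
qed simp

lemma cantor_set_C: "cantor_set C"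
proof (rule cantor_setI)
  fix a b :: real assume "a < b"
  then obtain n where "\<rho> ^ n < b - a" using real_arch_pow_inv[of "b - a" \<rho>] \<rho>_less by auto
  then have "\<not> {a..b} \<subseteq> stage n" using stage_interval_length[of a b n] \<open>a < b\<close> by auto
  then show "\<not> {a..b} \<subseteq> C" unfolding C_def by blast
qed (use compact_C C_perfect zero_in_C in auto)

section \<open>Regularity of the middle Cantor set\<close>

lemma expand_deriv:
  assumes "x \<noteq> 1/2"
  shows "(expand has_real_derivative 1 / \<rho>) (at x)"
proof (cases "x < 1/2")
  case True
  have "((\<lambda>x. x / \<rho>) has_real_derivative 1 / \<rho>) (at x)"
    using \<rho>_pos by (auto intro!: derivative_eq_intros)
  then show ?thesis
    by (rule has_field_derivative_transform_within_open[of _ _ _ "{..<1/2}"])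
      (use True in \<open>auto simp: expand_def\<close>)
next
  case False
  have "((\<lambda>x. (x - (1 - \<rho>)) / \<rho>) has_real_derivative 1 / \<rho>) (at x)"
    using \<rho>_pos by (auto intro!: derivative_eq_intros)
  then show ?thesis
    by (rule has_field_derivative_transform_within_open[of _ _ _ "{1/2<..}"])
      (use False assms in \<open>auto simp: expand_def\<close>)
qed

lemma expand_image_left: "expand ` {0..\<rho>} = {0..1}"
proof -
  have "expand ` {0..\<rho>} = (\<lambda>x. x / \<rho>) ` {0..\<rho>}"
    using \<rho>_less by (intro image_cong) (auto simp: expand_def)
  also have "\<dots> = {0..1}"
    using \<rho>_pos by (subst image_divide_atLeastAtMost) auto
  finally show ?thesis .
qed

lemma expand_image_right: "expand ` {1-\<rho>..1} = {0..1}"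
proof -
  have "expand ` {1-\<rho>..1} = (\<lambda>x. x / \<rho>) ` ((\<lambda>x. x - (1-\<rho>)) ` {1-\<rho>..1})"
    unfolding image_image using \<rho>_less by (intro image_cong) (auto simp: expand_def)
  also have "(\<lambda>x. x - (1-\<rho>)) ` {1-\<rho>..1} = {0..\<rho>}"
    by (subst image_minus_const_atLeastAtMost') auto
  also have "(\<lambda>x. x / \<rho>) ` {0..\<rho>} = {0..1}"
    using \<rho>_pos by (subst image_divide_atLeastAtMost) auto
  finally show ?thesis .
qed

lemma expand_image_C:
  assumes "J = {0..\<rho>} \<or> J = {1-\<rho>..1}"
  shows "expand ` (C \<inter> J) = C"
proof -
  have *: "expand ` J = {0..1}" "J \<subseteq> {0..\<rho>} \<union> {1-\<rho>..1}"
    using assms expand_image_left expand_image_right by auto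
  show ?thesis
  proof (intro equalityI subsetI)
    fix y assume y: "y \<in> C"
    then obtain x where "x \<in> J" "y = expand x"
      using * C_unit by (metis imageE in_mono)
    then show "y \<in> expand ` (C \<inter> J)" using y * C_iff[of x] by auto
  next
    fix y assume "y \<in> expand ` (C \<inter> J)"
    then show "y \<in> C" using C_iff by blast
  qed
qed

lemma expand_funpow_image_C: "(expand ^^ n) ` C = C"
proof (induction n)
  case (Suc n)
  have "expand ` C = expand ` (C \<inter> {0..\<rho>}) \<union> expand ` (C \<inter> {1-\<rho>..1})"
    using C_iff by blast
  then have "expand ` C = C" using expand_image_C by simp
  then show ?case using Suc image_comp[of expand "expand ^^ n" C] by simp
qed simp

text \<open>A point whose first \<open>n\<close> iterates, starting with the point itself, stay in
  the two intervals lies in \<open>stage n\<close>, by repeated use of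
  \<open>stage_Suc_iff\<close>.\<close>

lemma C_eq_Inter: "C = (\<Inter>n. (expand ^^ n) -` ({0..\<rho>} \<union> {1-\<rho>..1}))"
proof (intro equalityI subsetI)
  fix x assume "x \<in> C"
  then have "(expand ^^ n) x \<in> C" for n
    using expand_funpow_image_C by blast
  then show "x \<in> (\<Inter>n. (expand ^^ n) -` ({0..\<rho>} \<union> {1-\<rho>..1}))"
    using C_iff by blast
next
  fix x assume x: "x \<in> (\<Inter>n. (expand ^^ n) -` ({0..\<rho>} \<union> {1-\<rho>..1}))"
  have "x \<in> stage n" if "\<forall>n. (expand ^^ n) x \<in> {0..\<rho>} \<union> {1-\<rho>..1}" for n x
    using that
  proof (induction n arbitrary: x)
    case 0
    have "x \<in> {0..\<rho>} \<union> {1-\<rho>..1}" using 0[rule_format, of 0] by simp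
    then show ?case using \<rho>_pos \<rho>_less by auto
  next
    case (Suc n)
    have "x \<in> {0..\<rho>} \<union> {1-\<rho>..1}" using Suc.prems[rule_format, of 0] by simp
    moreover have "(expand ^^ n) (expand x) \<in> {0..\<rho>} \<union> {1-\<rho>..1}" for n
      using Suc.prems[rule_format, of "Suc n"] by (simp add: funpow_swap1)
    ultimately show ?case using stage_Suc_iff Suc.IH by blast
  qed
  then show "x \<in> C" using x unfolding C_def by blast
qed

text \<open>The map \<open>expand\<close> is a witness with \<open>k = 1\<close> on the line without
  1/2: its derivative is constantly \<open>1 / \<rho>\<close>, and it sends each of the two
  intervals onto \<open>{0..1}\<close>, the hull of their union.\<close>

lemma regular_cantor_set_C: "regular_cantor_set C"
proof -
  define I where "I j = (if j = 1 then {0..\<rho>} else {1-\<rho>..1})" for j :: nat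
  have set12: "{1..2} = {1, 2 :: nat}" by auto
  have UI: "(\<Union>j\<in>{1..2}. I j) = {0..\<rho>} \<union> {1-\<rho>..1}"
    unfolding set12 I_def by auto
  have I: "\<exists>a b. a < b \<and> I j = {a..b}" for j
  proof (cases "j = 1")
    case True
    then show ?thesis using \<rho>_pos I_def by metis
  next
    case False
    then have "I j = {1-\<rho>..1}" "1 - \<rho> < 1" using \<rho>_pos I_def by simp_all
    then show ?thesis by blast
  qed
  have disj: "disjoint_family_on I {1..2}"
    using \<rho>_less unfolding disjoint_family_on_def set12 I_def by auto
  have "expand 0 = 0" "expand \<rho> = 1" "expand (1-\<rho>) = 0" "expand 1 = 1"
    using \<rho>_pos \<rho>_less by (auto simp: expand_def)
  then have "{0, \<rho>, 1-\<rho>, 1} \<subseteq> C"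
    using C_iff[of \<rho>] C_iff[of "1-\<rho>"] zero_in_C one_in_C \<rho>_pos by auto
  then have fr: "frontier (I j) \<subseteq> C" for j
    using \<rho>_pos by (auto simp: I_def frontier_def)
  have nbhd: "(\<Union>j\<in>{1..2}. I j) \<subseteq> UNIV - {1/2}"
    using \<rho>_less unfolding UI by auto
  have der: "deriv expand x = 1 / \<rho>" if "x \<in> UNIV - {1/2}" for x
    using that expand_deriv DERIV_imp_deriv by blast
  have Ck: "C_k_on 1 expand (UNIV - {1/2})"
  proof -
    have "expand differentiable (at x)" if "x \<in> UNIV - {1/2}" for x
      using expand_deriv[of x] that
      by (auto simp: has_field_derivative_def differentiable_def)
    moreover have "continuous_on (UNIV - {1/2}) (deriv expand)"
      using der by (subst continuous_on_cong[OF refl, of _ _ "\<lambda>_. 1/\<rho>"]) auto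
    ultimately show ?thesis by (simp add: C_k_on_def)
  qed
  have ex: "expanding_on expand (UNIV - {1/2})"
    unfolding expanding_on_def using der \<rho>_pos \<rho>_less by (intro exI[of _ "1/\<rho>"]) auto
  have hull: "convex hull ({0..\<rho>} \<union> {1-\<rho>..1}) = {0..1}"
  proof
    show "convex hull ({0..\<rho>} \<union> {1-\<rho>..1}) \<subseteq> {0..1}"
      using \<rho>_pos \<rho>_less by (intro hull_minimal) auto
    have "{0..1} = convex hull {0, 1::real}"
      by (simp add: segment_convex_hull[symmetric] closed_segment_eq_real_ivl)
    also have "\<dots> \<subseteq> convex hull ({0..\<rho>} \<union> {1-\<rho>..1})"
      using \<rho>_pos by (intro hull_mono) auto
    finally show "{0..1} \<subseteq> convex hull ({0..\<rho>} \<union> {1-\<rho>..1})" .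
  qed
  have im: "\<exists>S\<subseteq>{1..2}. expand ` I j = convex hull (\<Union>s\<in>S. I s)" for j
    using UI hull expand_image_left expand_image_right
    by (intro exI[of _ "{1..2}"]) (auto simp: I_def)
  have ev: "\<forall>\<^sub>F n in sequentially. (expand ^^ n) ` (C \<inter> I j) = C" for j
    unfolding eventually_sequentially
  proof (intro exI allI impI)
    fix n :: nat assume "1 \<le> n"
    then obtain m where n: "n = Suc m" by (metis Suc_le_D One_nat_def)
    have "expand ` (C \<inter> I j) = C" by (rule expand_image_C) (simp add: I_def)
    then show "(expand ^^ n) ` (C \<inter> I j) = C"
      unfolding n funpow_Suc_right image_comp[symmetric] by (simp add: expand_funpow_image_C)
  qed
  have "C \<subseteq> (\<Union>j\<in>{1..2}. I j)"
    unfolding UI using C_iff by blast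
  then have "C_k_regular_cantor_set 1 C"
    unfolding C_k_regular_cantor_set_def
    using cantor_set_C I disj fr nbhd Ck ex im ev C_eq_Inter[folded UI]
    by (intro conjI exI[of _ "2::nat"] exI[of _ I] exI[of _ "UNIV - {1/2}"] exI[of _ expand])
      (auto simp: open_delete)
  then show ?thesis unfolding regular_cantor_set_def by blast
qed

section \<open>Separated points of each level\<close>

text \<open>The left endpoints of the intervals that make up \<open>stage n\<close>.\<close>

fun nodes :: "nat \<Rightarrow> real set" where
  "nodes 0 = {0}"
| "nodes (Suc n) = contr False ` nodes n \<union> contr True ` nodes n"

lemma nodes_C: "nodes n \<subseteq> C"
  using zero_in_C contr_C by (induction n) auto

text \<open>Nodes in different branches are \<open>1 - 2*\<rho>\<close> apart; every branch choice
  that two nodes share scales this by \<open>\<rho>\<close>, at most \<open>n\<close> times.\<close>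

lemma nodes_separated:
  "y \<in> nodes n \<Longrightarrow> z \<in> nodes n \<Longrightarrow> y \<noteq> z \<Longrightarrow> (1 - 2*\<rho>) * \<rho> ^ n \<le> \<bar>y - z\<bar>"
proof (induction n arbitrary: y z)
  case (Suc n)
  obtain a y' where y: "y' \<in> nodes n" "y = contr a y'" using Suc.prems by auto
  obtain b z' where z: "z' \<in> nodes n" "z = contr b z'" using Suc.prems by auto
  show ?case
  proof (cases "a = b")
    case True
    then have "(1 - 2*\<rho>) * \<rho> ^ n \<le> \<bar>y' - z'\<bar>" using Suc y z by auto
    moreover have "\<bar>y - z\<bar> = \<rho> * \<bar>y' - z'\<bar>"
      using y z True contr_diff \<rho>_pos by (simp add: abs_mult)
    ultimately show ?thesis using \<rho>_pos by (simp add: mult.left_commute)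
  next
    case False
    have u: "0 \<le> y'" "y' \<le> 1" "0 \<le> z'" "z' \<le> 1" 
      using y(1) z(1) nodes_C[of n] C_unit by auto
    have "1 - 2*\<rho> \<le> \<bar>y - z\<bar>"
      using contr_branches[OF u] contr_branches[OF u(3,4,1,2)] False y z
      by (cases a; cases b) auto
    moreover have "\<rho> ^ Suc n \<le> 1" using \<rho>_pos \<rho>_less by (intro power_le_one) auto
    then have "(1 - 2*\<rho>) * \<rho> ^ Suc n \<le> 1 - 2*\<rho>" using \<rho>_less by (intro mult_left_le) auto
    ultimately show ?thesis by linarith
  qed
qed simp

lemma card_nodes: "finite (nodes n) \<and> card (nodes n) = 2 ^ n"
proof (induction n)
  case (Suc n)
  have "contr False ` nodes n \<inter> contr True ` nodes n = {}"
  proof -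
    have "contr False y \<noteq> contr True z" if "y \<in> nodes n" "z \<in> nodes n" for y z
    proof -
      have "y \<in> {0..1}" "z \<in> {0..1}" using that nodes_C C_unit by blast+
      then show ?thesis using contr_branches[of z y] \<rho>_less by simp
    qed
    then show ?thesis by blast
  qed
  moreover have "inj (contr b)" for b
    using \<rho>_pos by (auto simp: inj_def contr_def)
  then have "card (contr b ` nodes n) = card (nodes n)" for b
    by (meson card_image inj_on_subset subset_UNIV)
  ultimately show ?case using Suc by (simp add: card_Un_disjoint)
qed simp

subsection \<open>Hausdorff dimension\<close>

definition doubling :: "real \<Rightarrow> real" where
  "doubling u = (if u < 1/2 then 2 * u else 2 * u - 1)"

text \<open>Binary digits of \<open>u\<close> in \<open>[0,1)\<close>, counted from 0; dyadic
  numbers receive the expansion ending in zeros.\<close>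

definition digit :: "real \<Rightarrow> nat \<Rightarrow> bool" where
  "digit u k \<longleftrightarrow> 1/2 \<le> (doubling ^^ k) u"

text \<open>The inverse of the Cantor function: the binary digits of \<open>u\<close> become an address in \<open>C\<close>. Since
  its inverse is \<open>d\<close>-Hoelder, covers of \<open>C\<close> pull back to covers of \<open>[0,1)\<close>.\<close>
definition code :: "real \<Rightarrow> real" where
  "code u = (\<Sum>k. of_bool (digit u k) * ((1 - \<rho>) * \<rho> ^ k))"

lemma weights_sums: "(\<lambda>k. (1 - \<rho>) * \<rho> ^ k) sums 1"
  using sums_mult[OF geometric_sums[of \<rho>], of "1 - \<rho>"] \<rho>_pos \<rho>_less by simp

lemma code_summable: "summable (\<lambda>k. of_bool (digit u k) * ((1 - \<rho>) * \<rho> ^ k))"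
  using \<rho>_pos \<rho>_less
  by (intro summable_comparison_test'[OF sums_summable[OF weights_sums]]) (auto simp: abs_mult)

lemma code_unit: "0 \<le> code u" "code u \<le> 1"
proof -
  show "0 \<le> code u" unfolding code_def
    using \<rho>_pos \<rho>_less by (intro suminf_nonneg code_summable) auto
  have "code u \<le> (\<Sum>k. (1 - \<rho>) * \<rho> ^ k)" unfolding code_def
    using \<rho>_pos \<rho>_less
    by (intro suminf_le code_summable sums_summable[OF weights_sums]) auto
  then show "code u \<le> 1" using sums_unique[OF weights_sums] by simp
qed

text \<open>Removing the leading digit is \<open>doubling\<close> on the parameter and the inverse
  of a branch on the code; inductions over digits rest on this conjugacy.\<close>

lemma code_contr: "code u = contr (1/2 \<le> u) (code (doubling u))"
proof -
  have shift: "digit u (Suc k) = digit (doubling u) k" for k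
    by (simp add: digit_def funpow_swap1)
  have "code u = of_bool (digit u 0) * (1 - \<rho>)
      + (\<Sum>k. of_bool (digit u (Suc k)) * ((1 - \<rho>) * \<rho> ^ Suc k))"
    using suminf_split_head[OF code_summable[of u]] unfolding code_def by simp
  also have "(\<Sum>k. of_bool (digit u (Suc k)) * ((1 - \<rho>) * \<rho> ^ Suc k)) = \<rho> * code (doubling u)"
    unfolding code_def shift suminf_mult[OF code_summable, symmetric] by (simp add: ac_simps)
  finally show ?thesis by (simp add: contr_def digit_def)
qed

lemma code_C: "code u \<in> C"
proof -
  have "code u \<in> stage n" for n
  proof (induction n arbitrary: u)
    case (Suc n)
    then show ?case using code_contr[of u] by (cases "1/2 \<le> u") auto
  qed (simp add: code_unit)
  then show ?thesis unfolding C_def by blast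
qed

text \<open>Different leading digits put the codes into branches \<open>1 - 2*\<rho>\<close> apart,
  so close codes share their leading digit. Removing it doubles the distance of the parameters and
  divides that of the codes by \<open>\<rho>\<close>.\<close>

lemma code_close:
  assumes "u \<in> {0..<1}" "v \<in> {0..<1}" "\<bar>code u - code v\<bar> < (1 - 2*\<rho>) * \<rho> ^ n"
  shows "\<bar>u - v\<bar> \<le> (1/2) ^ Suc n"
  using assms
proof (induction n arbitrary: u v)
  have same: "1/2 \<le> u \<longleftrightarrow> 1/2 \<le> v" if "\<bar>code u - code v\<bar> < 1 - 2*\<rho>" for u v
    using that code_contr[of u] code_contr[of v] code_unit
      contr_branches[of "code (doubling u)" "code (doubling v)"]
      contr_branches[of "code (doubling v)" "code (doubling u)"]
    by (cases "1/2 \<le> u"; cases "1/2 \<le> v") auto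
  {
    case 0
    then have "1/2 \<le> u \<longleftrightarrow> 1/2 \<le> v" using same[of u v] by simp
    then show ?case using 0(1,2) by (cases "1/2 \<le> u") (auto simp: abs_real_def)
  next
    case (Suc n)
    have "(1 - 2*\<rho>) * \<rho> ^ Suc n \<le> (1 - 2*\<rho>) * 1"
      using \<rho>_pos \<rho>_less by (intro mult_left_mono power_le_one) auto
    then have same: "1/2 \<le> u \<longleftrightarrow> 1/2 \<le> v" using same Suc.prems by simp
    then have "\<bar>code u - code v\<bar> = \<rho> * \<bar>code (doubling u) - code (doubling v)\<bar>"
      using code_contr[of u] code_contr[of v] contr_diff \<rho>_pos by (simp add: abs_mult)
    then have "\<bar>code (doubling u) - code (doubling v)\<bar> < (1 - 2*\<rho>) * \<rho> ^ n"
      using Suc.prems(3) \<rho>_pos by (simp add: mult.left_commute)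
    moreover have "doubling u \<in> {0..<1}" "doubling v \<in> {0..<1}"
      using Suc.prems by (auto simp: doubling_def)
    ultimately have "\<bar>doubling u - doubling v\<bar> \<le> (1/2) ^ Suc n" using Suc.IH by blast
    moreover have "\<bar>doubling u - doubling v\<bar> = 2 * \<bar>u - v\<bar>"
      using same by (cases "1/2 \<le> u") (auto simp: doubling_def abs_real_def)
    ultimately show ?case by simp
  }
qed

text \<open>The equation \<open>\<rho> powr d = 1/2\<close> converts the scale
  \<open>\<rho> ^ n\<close> of codes into the scale \<open>(1/2) ^ n\<close> of parameters.\<close>

lemma code_inverse_Hoelder:
  assumes d: "0 < d" "\<rho> powr d = 1/2" and uv: "u \<in> {0..<1}" "v \<in> {0..<1}"
  shows "\<bar>u - v\<bar> \<le> (\<bar>code u - code v\<bar> / (1 - 2*\<rho>)) powr d"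
proof -
  define D where "D = \<bar>code u - code v\<bar> / (1 - 2*\<rho>)"
  have D0: "0 \<le> D" using \<rho>_less by (simp add: D_def)
  have close: "\<bar>u - v\<bar> \<le> (1/2) ^ Suc n" if "D < \<rho> ^ n" for n
    using that code_close[OF uv, of n] \<rho>_less by (simp add: D_def divide_less_eq mult.commute)
  show ?thesis unfolding D_def[symmetric]
  proof (cases "D = 0")
    \<comment> \<open>Here \<open>D powr d\<close> is 0, so equality of \<open>u\<close> and
      \<open>v\<close> is needed; it follows since \<open>close\<close> applies at every
      level.\<close>
    case True
    have "\<bar>u - v\<bar> \<le> 0"
    proof (rule ccontr)
      assume "\<not> \<bar>u - v\<bar> \<le> 0"
      then obtain n where "(1/2) ^ n < \<bar>u - v\<bar>"
        using real_arch_pow_inv[of "\<bar>u - v\<bar>" "1/2"] by auto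
      moreover have "(1/2::real) ^ Suc n \<le> (1/2) ^ n" by simp
      ultimately show False using close[of n] True \<rho>_pos abs_ge_zero[of "u - v"] by simp
    qed
    then show "\<bar>u - v\<bar> \<le> D powr d" by (meson order_trans powr_ge_zero)
  next
    case False
    then have "0 < D" using D0 by simp
    show "\<bar>u - v\<bar> \<le> D powr d"
    proof (cases "D < 1")
      case True
      obtain m where m: "\<rho> ^ m < D" using real_arch_pow_inv[OF \<open>0 < D\<close>, of \<rho>] \<rho>_less by auto
      \<comment> \<open>Minimality gives \<open>D < \<rho> ^ (n - 1)\<close>, and the extra factor
        1/2 in \<open>close\<close> then yields exactly \<open>(1/2) ^ n\<close>, with no loss of a
        constant.\<close>
      define n where "n = (LEAST m. \<rho> ^ m \<le> D)"
      have n: "\<rho> ^ n \<le> D" unfolding n_def by (rule LeastI[of _ m]) (use m in simp)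
      have "n \<noteq> 0" using n True by (intro notI) simp
      then obtain k where k: "n = Suc k" using not0_implies_Suc by blast
      have "\<not> \<rho> ^ k \<le> D" using not_less_Least[of k "\<lambda>m. \<rho> ^ m \<le> D"] k n_def by simp
      then have "\<bar>u - v\<bar> \<le> (1/2) ^ n" using close[of k] k by simp
      also have "\<dots> = (\<rho> ^ n) powr d"
        using \<rho>_pos d by (simp flip: d(2) add: powr_realpow[symmetric] powr_powr mult.commute)
      also have "\<dots> \<le> D powr d" using n d \<rho>_pos by (intro powr_mono2) auto
      finally show ?thesis .
    next
      case False
      have "\<bar>u - v\<bar> \<le> 1" using uv by auto
      also have "1 \<le> D powr d" using False d by (intro ge_one_powr_ge_zero) auto
      finally show ?thesis .
    qed
  qed
qed

text \<open>A mass distribution argument: the preimages of the covering sets under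
  \<open>code\<close> cover \<open>[0,1)\<close> and have controlled diameter, so the total length 1
  bounds the sum from below. The factor 2 passes from radius to length.\<close>

lemma Hausdorff_sum_lower:
  assumes d: "0 < d" "\<rho> powr d = 1/2"
    and U: "C \<subseteq> (\<Union>i. U i)" "\<And>i. bounded (U i)"
  shows "1 \<le> (\<Sum>i. ennreal ((diameter (U i) / (1 - 2*\<rho>)) powr d)) * 2"
proof -
  define r where "r i = (diameter (U i) / (1 - 2*\<rho>)) powr d" for i :: nat
  define V where "V i = {u\<in>{0..<1}. code u \<in> U i}" for i
  \<comment> \<open>The sets \<open>V i\<close> need not be measurable, so each is first enclosed in
    an interval around one of its points.\<close>
  have "\<exists>c. V i \<subseteq> {c - r i..c + r i}" for i
  proof (cases "V i = {}")
    case False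
    then obtain c where c: "c \<in> V i" by blast
    have "V i \<subseteq> {c - r i..c + r i}"
    proof
      fix u assume u: "u \<in> V i"
      have "\<bar>code u - code c\<bar> \<le> diameter (U i)"
        using diameter_bounded_bound[OF U(2), of "code u" i "code c"] u c
        by (simp add: V_def dist_real_def)
      then have "(\<bar>code u - code c\<bar> / (1 - 2*\<rho>)) powr d \<le> r i"
        unfolding r_def using \<rho>_less d by (intro powr_mono2 divide_right_mono) auto
      moreover have "\<bar>u - c\<bar> \<le> (\<bar>code u - code c\<bar> / (1 - 2*\<rho>)) powr d"
        using code_inverse_Hoelder[OF d] u c by (simp add: V_def)
      ultimately show "u \<in> {c - r i..c + r i}" by auto
    qed
    then show ?thesis by blast
  qed simp
  then obtain c where c: "\<And>i. V i \<subseteq> {c i - r i..c i + r i}" by metis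
  have r0: "0 \<le> r i" for i by (simp add: r_def)
  have "{0..<1} \<subseteq> (\<Union>i. {c i - r i..c i + r i})"
  proof
    fix u :: real assume u: "u \<in> {0..<1}"
    then obtain i where "u \<in> V i" using U(1) code_C[of u] by (auto simp: V_def)
    then show "u \<in> (\<Union>i. {c i - r i..c i + r i})" using c by blast
  qed
  then have "emeasure lborel {0..<1::real} \<le> emeasure lborel (\<Union>i. {c i - r i..c i + r i})"
    by (intro emeasure_mono) auto
  also have "\<dots> \<le> (\<Sum>i. emeasure lborel {c i - r i..c i + r i})"
    by (intro emeasure_subadditive_countably) auto
  also have "\<dots> = (\<Sum>i. ennreal (r i) * 2)"
  proof (intro suminf_cong)
    fix i
    have "emeasure lborel {c i - r i..c i + r i} = ennreal (r i * 2)" using r0[of i] by simp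
    then show "emeasure lborel {c i - r i..c i + r i} = ennreal (r i) * 2"
      using r0[of i] by (simp add: ennreal_mult)
  qed
  also have "\<dots> = (\<Sum>i. ennreal (r i)) * 2" by (rule ennreal_suminf_multc)
  finally show ?thesis by (simp add: r_def)
qed

text \<open>Already the premeasure at scale 1 is positive: for diameters at most 1 the power
  \<open>s\<close> dominates the power \<open>d\<close>, so the bound for exponent \<open>d\<close>
  covers all smaller exponents.\<close>

lemma hausdorff_measure_pos:
  assumes d: "0 < d" "\<rho> powr d = 1/2" and s: "0 < s" "s \<le> d"
  shows "0 < hausdorff_measure s C"
proof -
  define m where "m = ennreal ((1 - 2*\<rho>) powr d) / 2"
  have "0 < m" using \<rho>_less by (simp add: m_def ennreal_zero_less_divide)
  also have "m \<le> hausdorff_premeasure s 1 C"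
    unfolding hausdorff_premeasure_def
  proof (intro INF_greatest)
    fix U :: "nat \<Rightarrow> real set"
    assume "U \<in> {U. C \<subseteq> (\<Union>i. U i) \<and> (\<forall>i. bounded (U i) \<and> diameter (U i) \<le> 1)}"
    then have U: "C \<subseteq> (\<Union>i. U i)" "\<And>i. bounded (U i)" "\<And>i. diameter (U i) \<le> 1" by auto
    have D0: "0 \<le> diameter (U i)" for i using diameter_ge_0 U by blast
    let ?c = "ennreal ((1 - 2*\<rho>) powr d)"
    let ?S = "\<Sum>i. ennreal (diameter (U i) powr s)"
    have "ennreal ((diameter (U i) / (1 - 2*\<rho>)) powr d) * ?c \<le> ennreal (diameter (U i) powr s)" for i
    proof -
      have "(diameter (U i) / (1 - 2*\<rho>)) powr d * (1 - 2*\<rho>) powr d = diameter (U i) powr d"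
        using \<rho>_less D0[of i] by (simp add: powr_divide)
      also have "\<dots> \<le> diameter (U i) powr s"
        using U(3)[of i] D0[of i] s by (cases "diameter (U i) = 0") (auto intro: powr_mono')
      finally show ?thesis by (simp add: ennreal_mult[symmetric])
    qed
    then have "(\<Sum>i. ennreal ((diameter (U i) / (1 - 2*\<rho>)) powr d) * ?c) \<le> ?S"
      by (intro suminf_le) auto
    then have le: "(\<Sum>i. ennreal ((diameter (U i) / (1 - 2*\<rho>)) powr d)) * ?c \<le> ?S"
      by (simp only: ennreal_suminf_multc)
    have "1 * ?c \<le> (\<Sum>i. ennreal ((diameter (U i) / (1 - 2*\<rho>)) powr d)) * 2 * ?c"
      by (intro mult_right_mono Hausdorff_sum_lower[OF d U(1,2)]) auto
    also have "\<dots> = (\<Sum>i. ennreal ((diameter (U i) / (1 - 2*\<rho>)) powr d)) * ?c * 2"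
      by (simp add: ac_simps)
    also have "\<dots> \<le> ?S * 2" using le by (intro mult_right_mono) auto
    finally show "m \<le> ?S" unfolding m_def by (simp add: divide_le_posI_ennreal mult.commute)
  qed
  also have "\<dots> \<le> hausdorff_measure s C"
    unfolding hausdorff_measure_def by (intro SUP_upper) auto
  finally show ?thesis .
qed

lemma stage_cover:
  "\<exists>f. C \<subseteq> (\<Union>i<(2::nat)^n. {f i..f i + \<rho> ^ n})"
proof -
  have "C \<subseteq> (\<Union>y\<in>nodes n. {y..y + \<rho> ^ n})"
  proof (induction n)
    case 0
    then show ?case using C_unit by auto
  next
    case (Suc n)
    show ?case
    proof
      fix x assume "x \<in> C"
      then obtain b z where z: "z \<in> C" "x = contr b z" using C_cases by blast
      then obtain y where y: "y \<in> nodes n" "y \<le> z" "z \<le> y + \<rho> ^ n" using Suc by fastforce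
      have "contr b y \<in> nodes (Suc n)" using y by (cases b) auto
      moreover have "x - contr b y = \<rho> * (z - y)" using z contr_diff by simp
      moreover have "0 \<le> \<rho> * (z - y)" "\<rho> * (z - y) \<le> \<rho> * \<rho> ^ n"
        using y \<rho>_pos by auto
      ultimately show "x \<in> (\<Union>y\<in>nodes (Suc n). {y..y + \<rho> ^ Suc n})"
        by (intro UN_I[of "contr b y"]) auto
    qed
  qed
  moreover obtain f where "bij_betw f {0..<card (nodes n)} (nodes n)"
    using card_nodes ex_bij_betw_nat_finite by blast
  then have "nodes n = f ` {..<(2::nat)^n}" 
    using card_nodes[of n] by (simp add: bij_betw_def lessThan_atLeast0)
  ultimately show ?thesis by (intro exI[of _ f]) auto
qed

text \<open>The \<open>2 ^ n\<close> intervals of length \<open>\<rho> ^ n\<close> have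
  \<open>s\<close>-sum \<open>(2 * \<rho> powr s) ^ n\<close>, which tends to 0 since
  \<open>2 * \<rho> powr d = 1\<close> and \<open>s > d\<close>.\<close>

lemma hausdorff_measure_zero:
  assumes d: "0 < d" "\<rho> powr d = 1/2" and s: "d < s"
  shows "hausdorff_measure s C = 0"
proof -
  have \<theta>: "2 * \<rho> powr s < 1" "0 < 2 * \<rho> powr s"
    using powr_less_mono'[of \<rho> d s] \<rho>_pos \<rho>_less d s by auto
  have "hausdorff_premeasure s \<delta> C \<le> 0" if "0 < \<delta>" for \<delta>
  proof (rule ennreal_le_epsilon)
    fix e :: real assume "0 < e"
    have "(\<lambda>n. (2 * \<rho> powr s) ^ n) \<longlonglongrightarrow> 0"
      using \<theta> by (intro LIMSEQ_abs_realpow_zero2) auto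
    then have "\<forall>\<^sub>F n in sequentially. (2 * \<rho> powr s) ^ n < e"
      using \<open>0 < e\<close> by (intro order_tendstoD)
    moreover have "(\<lambda>n. \<rho> ^ n) \<longlonglongrightarrow> 0"
      using \<rho>_pos \<rho>_less by (intro LIMSEQ_abs_realpow_zero2) auto
    then have "\<forall>\<^sub>F n in sequentially. \<rho> ^ n < \<delta>"
      using \<open>0 < \<delta>\<close> by (intro order_tendstoD)
    ultimately have "\<forall>\<^sub>F n in sequentially. (2 * \<rho> powr s) ^ n < e \<and> \<rho> ^ n < \<delta>"
      by (rule eventually_conj)
    then obtain n where n: "(2 * \<rho> powr s) ^ n < e" "\<rho> ^ n < \<delta>"
      unfolding eventually_sequentially by blast
    obtain f where f: "C \<subseteq> (\<Union>i<(2::nat)^n. {f i..f i + \<rho> ^ n})" using stage_cover by blast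
    \<comment> \<open>Padding with empty sets gives the required infinite sequence at no cost, as
      \<open>0 powr s = 0\<close>.\<close>
    define U where "U i = (if i < 2^n then {f i..f i + \<rho> ^ n} else {})" for i :: nat
    have \<rho>n: "0 < \<rho> ^ n" using \<rho>_pos by simp
    have diam: "diameter (U i) = (if i < 2^n then \<rho> ^ n else 0)" for i
      using \<rho>_pos by (simp add: U_def diameter_closed_interval)
    have "C \<subseteq> (\<Union>i. U i)" using f by (force simp: U_def)
    then have "hausdorff_premeasure s \<delta> C \<le> (\<Sum>i. ennreal (diameter (U i) powr s))"
      unfolding hausdorff_premeasure_def
      using n \<open>0 < \<delta>\<close> by (intro INF_lower) (auto simp: diam, simp add: U_def)
    also have "\<dots> = (\<Sum>i<2^n. ennreal (diameter (U i) powr s))"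
      by (intro suminf_finite) (auto simp: diam)
    also have "\<dots> = (\<Sum>i<(2::nat)^n. ennreal ((\<rho> ^ n) powr s))"
      by (intro sum.cong) (auto simp: diam)
    also have "\<dots> = ennreal (2 ^ n * (\<rho> ^ n) powr s)"
      by (simp add: ennreal_mult ennreal_power[symmetric])
    also have "2 ^ n * (\<rho> ^ n) powr s = (2 * \<rho> powr s) ^ n"
      using \<rho>_pos by (simp add: power_mult_distrib powr_realpow[symmetric] powr_powr mult.commute)
    also have "ennreal \<dots> \<le> 0 + ennreal e" using n by (simp add: ennreal_leI)
    finally show "hausdorff_premeasure s \<delta> C \<le> 0 + ennreal e" .
  qed
  then show ?thesis unfolding hausdorff_measure_def by (auto simp: SUP_eq_iff bot_ennreal)
qed

lemma hausdorff_dim_C: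
  assumes d: "0 < d" "\<rho> powr d = 1/2"
  shows "hausdorff_dim C = ennreal d"
  unfolding hausdorff_dim_def
proof (intro antisym)
  show "ennreal d \<le> Inf {ennreal s |s. 0 < s \<and> hausdorff_measure s C = 0}"
  proof (intro Inf_greatest)
    fix x assume "x \<in> {ennreal s |s. 0 < s \<and> hausdorff_measure s C = 0}"
    then obtain s where s: "x = ennreal s" "0 < s" "hausdorff_measure s C = 0" by blast
    then have "\<not> s \<le> d" using hausdorff_measure_pos[OF d] by fastforce
    then show "ennreal d \<le> x" using s by (simp add: ennreal_leI)
  qed
next
  show "Inf {ennreal s |s. 0 < s \<and> hausdorff_measure s C = 0} \<le> ennreal d"
  proof (rule ennreal_le_epsilon)
    fix e :: real assume "0 < e"
    then have "Inf {ennreal s |s. 0 < s \<and> hausdorff_measure s C = 0} \<le> ennreal (d + e)"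
      using hausdorff_measure_zero[OF d, of "d + e"] d by (intro Inf_lower CollectI exI[of _ "d + e"]) auto
    then show "Inf {ennreal s |s. 0 < s \<and> hausdorff_measure s C = 0} \<le> ennreal d + ennreal e"
      using d \<open>0 < e\<close> by (simp add: ennreal_plus)
  qed
qed

subsection \<open>Finitely many intervals meeting all large copies\<close>

text \<open>The pair \<open>(i, j)\<close> stands for the copy \<open>i \<delta> C + j \<delta>\<close>, and \<open>G (i, j)\<close> lists the cells of length \<open>\<delta>\<close>
  met by its nodes. The choice of \<open>\<delta>\<close> separates the scaled nodes by at least one cell.\<close>
lemma hitting_points_at_scale:
  fixes L \<delta> \<beta> :: real and n N :: nat
  assumes L: "0 < L" "L \<le> 1"
    and \<delta>: "\<delta> = L * (1 - 2*\<rho>) / 2 * \<rho> ^ n"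
    and \<beta>: "\<beta> = 2 ^ n * \<delta> / 3"
    and N: "ln (5 / \<delta>\<^sup>2) / \<beta> \<le> real N"
  shows "\<exists>x. \<forall>l\<in>{L..1}. \<forall>t\<in>{0..1}. \<exists>k<N. \<exists>y\<in>C. \<bar>l * y + t - x k\<bar> < 3 * \<delta>"
proof -
  have \<rho>n: "0 < \<rho> ^ n" "\<rho> ^ n \<le> 1" using \<rho>_pos \<rho>_less by (auto intro: power_le_one)
  have \<delta>0: "0 < \<delta>" unfolding \<delta> using L \<rho>n \<rho>_less by auto
  have "L * (1 - 2*\<rho>) \<le> 1" using L \<rho>_pos \<rho>_less by (intro mult_le_one) auto
  then have "L * (1 - 2*\<rho>) / 2 * \<rho> ^ n \<le> 1/2 * 1"
    using \<rho>n by (intro mult_mono) auto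
  then have \<delta>1: "\<delta> \<le> 1/2" using \<delta> by simp
  have \<beta>0: "0 < \<beta>" unfolding \<beta> using \<delta>0 by simp
  have "2 ^ n * \<delta> = L * (1 - 2*\<rho>) / 2 * (2 * \<rho>) ^ n"
    by (simp add: \<delta> power_mult_distrib)
  also have "\<dots> \<le> 1/2 * 1"
    using \<open>L * (1 - 2*\<rho>) \<le> 1\<close> \<rho>_pos \<rho>_less by (intro mult_mono power_le_one) auto
  finally have \<beta>1: "\<beta> \<le> 1" using \<beta> by simp
  define m where "m = nat \<lfloor>1/\<delta>\<rfloor>"
  have m: "real m \<le> 1/\<delta>" using \<delta>0 by (simp add: m_def)
  \<comment> \<open>This contains every pair obtained by rounding down \<open>l/\<delta>\<close> and
    \<open>t/\<delta>\<close>; the \<open>- 1\<close> allows for the rounding of the first.\<close>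
  define A where "A = {(i, j). i \<le> m \<and> j \<le> m \<and> L/\<delta> - 1 \<le> real i}"
  have A_sub: "A \<subseteq> {0..m} \<times> {0..m}" by (auto simp: A_def)
  then have finA: "finite A" by (rule finite_subset) simp
  have "card A \<le> card ({0..m} \<times> {0..m})" using A_sub by (intro card_mono) auto
  then have "card A \<le> (m + 1)\<^sup>2" by (simp add: power2_eq_square)
  then have "real (card A) \<le> (real m + 1)\<^sup>2"
    by (metis of_nat_1 of_nat_add of_nat_le_iff of_nat_power)
  also have "\<dots> \<le> (2 / \<delta>)\<^sup>2"
    using m \<delta>0 \<delta>1 by (intro power_mono) (auto simp: field_simps)
  finally have cardA: "real (card A) \<le> 4 / \<delta>\<^sup>2" by (simp add: power_divide)
  define B where "B = {0..2 * m}"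
  have "real (card B) \<le> 3 / \<delta>"
    using m \<delta>0 \<delta>1 by (simp add: B_def field_simps)
  then have "\<beta> * card B \<le> \<beta> * (3 / \<delta>)" using \<beta>0 by (intro mult_left_mono) auto
  also have "\<dots> = 2 ^ n" using \<beta> \<delta>0 by simp
  finally have cardB: "\<beta> * card B \<le> 2 ^ n" .
  define G where "G = (\<lambda>(i, j). (\<lambda>y. nat \<lfloor>real i * y\<rfloor> + j) ` nodes n)"
  have unit: "0 \<le> y \<and> y \<le> 1" if "y \<in> nodes n" for y using that nodes_C C_unit by force
  have G: "G a \<subseteq> B \<and> \<beta> * card B \<le> card (G a)" if "a \<in> A" for a
  proof -
    obtain i j where a: "a = (i, j)" by fastforce
    have ij: "i \<le> m" "j \<le> m" "L/\<delta> - 1 \<le> real i" using that a by (auto simp: A_def)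
    have "nat \<lfloor>real i * y\<rfloor> \<le> m" if "y \<in> nodes n" for y
    proof -
      have "real i * y \<le> real i" using unit[OF that] by (simp add: mult_left_le)
      then have "\<lfloor>real i * y\<rfloor> \<le> int i" using floor_mono by fastforce
      then show ?thesis using ij by linarith
    qed
    then have sub: "G a \<subseteq> B" using ij a by (force simp: G_def B_def)
    have "inj_on (\<lambda>y. nat \<lfloor>real i * y\<rfloor> + j) (nodes n)"
    proof (rule inj_onI, rule ccontr)
      fix y z assume yz: "y \<in> nodes n" "z \<in> nodes n" "y \<noteq> z"
        "nat \<lfloor>real i * y\<rfloor> + j = nat \<lfloor>real i * z\<rfloor> + j"
      have "0 \<le> real i * y" "0 \<le> real i * z" using yz unit by auto
      then have "\<lfloor>real i * y\<rfloor> = \<lfloor>real i * z\<rfloor>" using yz(4)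
        by (simp add: eq_nat_nat_iff)
      then have "\<bar>real i * y - real i * z\<bar> < 1" by linarith
      then have less1: "real i * \<bar>y - z\<bar> < 1" by (simp add: abs_mult flip: right_diff_distrib)
      \<comment> \<open>By the choice of \<open>\<delta>\<close>, the factor
        \<open>L/\<delta>\<close> scales the node separation to 2. Rounding costs at most one more
        unit, so scaled nodes stay at least one cell apart.\<close>
      have "1 \<le> 2 - (1 - 2*\<rho>) * \<rho> ^ n"
        using mult_le_one[of "1 - 2*\<rho>" "\<rho> ^ n"] \<rho>n \<rho>_pos by simp
      also have "\<dots> = (L/\<delta> - 1) * ((1 - 2*\<rho>) * \<rho> ^ n)"
      proof -
        define w where "w = (1 - 2*\<rho>) * \<rho> ^ n"
        have "0 < w" "\<delta> = L * w / 2"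
          using \<rho>n \<rho>_less \<delta> by (simp_all add: w_def mult.assoc)
        then have "L / \<delta> * w = 2" using L by (subst \<open>\<delta> = L * w / 2\<close>) simp
        then have "2 - w = (L/\<delta> - 1) * w" by (simp add: left_diff_distrib)
        then show ?thesis by (simp only: w_def)
      qed
      also have "\<dots> \<le> real i * ((1 - 2*\<rho>) * \<rho> ^ n)"
        using ij \<rho>n \<rho>_less by (intro mult_right_mono) auto
      also have "\<dots> \<le> real i * \<bar>y - z\<bar>"
        using nodes_separated yz by (intro mult_left_mono) auto
      finally show False using less1 by simp
    qed
    then have "card (G a) = 2 ^ n"
      using card_nodes[of n] by (simp add: G_def a card_image)
    then show ?thesis using sub cardB by simp
  qed
  \<comment> \<open>The 5 in the bound for \<open>N\<close> exceeds the 4 in \<open>cardA\<close>,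
    which makes the final product strictly less than 1.\<close>
  have "(1 - \<beta>) ^ N \<le> exp (- \<beta>) ^ N"
    using \<beta>1 exp_ge_add_one_self[of "-\<beta>"] by (intro power_mono) auto
  also have "\<dots> = exp (- (\<beta> * real N))" by (simp add: exp_of_nat_mult[symmetric] mult.commute)
  also have "\<dots> \<le> exp (- ln (5 / \<delta>\<^sup>2))"
    using N \<beta>0 by (simp add: divide_le_eq mult.commute)
  also have "\<dots> = \<delta>\<^sup>2 / 5" using \<delta>0 by (simp add: exp_minus)
  finally have "card A * (1 - \<beta>) ^ N \<le> (4 / \<delta>\<^sup>2) * (\<delta>\<^sup>2 / 5)"
    using cardA \<beta>1 by (intro mult_mono) auto
  also have "\<dots> < 1" using \<delta>0 by simp
  finally have "card A * (1 - \<beta>) ^ N < 1" .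
  moreover have "finite B" "B \<noteq> {}" by (auto simp: B_def)
  ultimately obtain x where x: "\<forall>a\<in>A. \<exists>k<N. x k \<in> G a"
    using hitting_sequence[of A B \<beta> G N] finA \<beta>1 G by blast
  have "\<exists>k<N. \<exists>y\<in>C. \<bar>l * y + t - real (x k) * \<delta>\<bar> < 3 * \<delta>"
    if l: "l \<in> {L..1}" and t: "t \<in> {0..1}" for l t
  proof -
    define i j where "i = nat \<lfloor>l / \<delta>\<rfloor>" and "j = nat \<lfloor>t / \<delta>\<rfloor>"
    have pos: "0 \<le> l / \<delta>" "0 \<le> t / \<delta>" using l t L \<delta>0 by auto
    have i: "real i \<le> l / \<delta>" "l / \<delta> < real i + 1" and j: "real j \<le> t / \<delta>" "t / \<delta> < real j + 1"
      using pos by (simp_all add: i_def j_def)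
    have "i \<le> m" "j \<le> m" unfolding i_def j_def m_def
      using l t \<delta>0 by (auto intro!: nat_mono floor_mono divide_right_mono)
    moreover have "L / \<delta> \<le> l / \<delta>" using l \<delta>0 by (simp add: divide_right_mono)
    ultimately have "(i, j) \<in> A" using i by (auto simp: A_def)
    then obtain k y where k: "k < N" "y \<in> nodes n" "x k = nat \<lfloor>real i * y\<rfloor> + j"
      using x unfolding G_def by fastforce
    have y: "0 \<le> y" "y \<le> 1" "y \<in> C" using k unit nodes_C by auto
    define q where "q = real (nat \<lfloor>real i * y\<rfloor>)"
    have q: "q \<le> real i * y" "real i * y < q + 1" using y by (simp_all add: q_def)
    \<comment> \<open>Three nonnegative rounding errors, of the scale, the translation and the
      scaled node, each at most one cell: hence the constant 3.\<close>
    have "l / \<delta> * y + t / \<delta> - (q + real j) = (l/\<delta> - i) * y + (t/\<delta> - j) + (real i * y - q)"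
      by (simp add: algebra_simps)
    moreover have "0 \<le> (l/\<delta> - i) * y" "(l/\<delta> - i) * y \<le> 1"
      using i y by (auto intro: mult_le_one)
    ultimately have "\<bar>l / \<delta> * y + t / \<delta> - (q + real j)\<bar> < 3"
      using j q by linarith
    then have "\<delta> * \<bar>l / \<delta> * y + t / \<delta> - (q + real j)\<bar> < \<delta> * 3" using \<delta>0 by simp
    also have "\<delta> * \<bar>l / \<delta> * y + t / \<delta> - (q + real j)\<bar> = \<bar>\<delta> * (l / \<delta> * y + t / \<delta> - (q + real j))\<bar>"
      using \<delta>0 by (simp add: abs_mult)
    also have "\<delta> * (l / \<delta> * y + t / \<delta> - (q + real j)) = l * y + t - real (x k) * \<delta>"
      using \<delta>0 k by (simp add: q_def field_simps)
    finally have "\<bar>l * y + t - real (x k) * \<delta>\<bar> < 3 * \<delta>" by (simp only: mult.commute)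
    then show ?thesis using k(1) y(3) by blast
  qed
  then show ?thesis by (intro exI[of _ "\<lambda>k. real (x k) * \<delta>"]) blast
qed

text \<open>The number of points grows like \<open>n / (2 * \<rho>) ^ n\<close> times a constant,
  and the power of the length like \<open>(\<rho> powr p) ^ n\<close>. The hypothesis on
  \<open>p\<close> makes the geometric factor \<open>\<theta>\<close> in the total cost less than
  1.\<close>

lemma hitting_points:
  fixes p L \<eta> :: real
  assumes p: "0 < p" "\<rho> powr p < 2 * \<rho>" and L: "0 < L" "L \<le> 1" and "0 < \<eta>"
  shows "\<exists>x N \<epsilon>. 0 < \<epsilon> \<and> real N * (2 * \<epsilon>) powr p < \<eta> \<and>
    (\<forall>l\<in>{L..1}. \<forall>t\<in>{0..1}. \<exists>k<N. \<exists>y\<in>C. \<bar>l * y + t - x k\<bar> < \<epsilon>)"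
proof -
  define \<kappa> where "\<kappa> = L * (1 - 2*\<rho>) / 2"
  have \<kappa>0: "0 < \<kappa>" unfolding \<kappa>_def using L \<rho>_less by auto
  define \<delta> where "\<delta> n = \<kappa> * \<rho> ^ n" for n
  define \<beta> where "\<beta> n = 2 ^ n * \<delta> n / 3" for n
  define N where "N n = nat \<lceil>ln (5 / (\<delta> n)\<^sup>2) / \<beta> n\<rceil>" for n
  have \<delta>0: "0 < \<delta> n" for n unfolding \<delta>_def using \<kappa>0 \<rho>_pos by simp
  have \<beta>0: "0 < \<beta> n" for n unfolding \<beta>_def using \<delta>0 by simp
  define \<theta> \<sigma> where "\<theta> = \<rho> powr p / (2 * \<rho>)" and "\<sigma> = \<rho> powr p"
  have \<theta>: "\<bar>\<theta>\<bar> < 1" and \<sigma>: "\<bar>\<sigma>\<bar> < 1" using p \<rho>_pos \<rho>_less by (auto simp: \<theta>_def \<sigma>_def)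
  define a b c e where "a = ln (5 / \<kappa>\<^sup>2)" and "b = 2 * ln (1 / \<rho>)"
    and "c = 3 / \<kappa> * (6 * \<kappa>) powr p" and "e = (6 * \<kappa>) powr p"
  \<comment> \<open>An upper bound for \<open>N n * (6 * \<delta> n) powr p\<close>, where
    \<open>6 * \<delta> n\<close> is \<open>2 * \<epsilon>\<close> for
    \<open>\<epsilon> = 3 * \<delta> n\<close>. The linear factor stems from the logarithm, the last
    term from rounding \<open>N n\<close> up.\<close>
  define F where "F n = (a * c) * \<theta> ^ n + (b * c) * (real n * \<theta> ^ n) + e * \<sigma> ^ n" for n
  have "(\<lambda>n. F n) \<longlonglongrightarrow> (a * c) * 0 + (b * c) * 0 + e * 0" unfolding F_def
    using \<theta> \<sigma> by (intro tendsto_intros LIMSEQ_abs_realpow_zero2 powser_times_n_limit_0) auto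
  then have "\<forall>\<^sub>F n in sequentially. F n < \<eta>" using \<open>0 < \<eta>\<close> by (intro order_tendstoD) auto
  moreover have "\<forall>\<^sub>F n in sequentially. \<delta> n < 1"
  proof -
    have "(\<lambda>n. \<kappa> * \<rho> ^ n) \<longlonglongrightarrow> \<kappa> * 0"
      using \<rho>_pos \<rho>_less by (intro tendsto_mult_left LIMSEQ_abs_realpow_zero2) auto
    then show ?thesis unfolding \<delta>_def by (intro order_tendstoD(2)) auto
  qed
  ultimately have "\<forall>\<^sub>F n in sequentially. F n < \<eta> \<and> \<delta> n < 1" by (rule eventually_conj)
  then obtain n where Fn: "F n < \<eta>" and \<delta>1: "\<delta> n < 1"
    unfolding eventually_sequentially by blast
  \<comment> \<open>A nonnegative logarithm ensures that \<open>nat\<close> does not truncate the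
    ceiling in \<open>N n\<close>.\<close>
  have "(\<delta> n)\<^sup>2 \<le> 1" using \<delta>1 \<delta>0[of n] by (simp add: power_le_one)
  then have ln0: "0 \<le> ln (5 / (\<delta> n)\<^sup>2)" using \<delta>0[of n] by (simp add: field_simps)
  have "5 / (\<delta> n)\<^sup>2 = 5 / \<kappa>\<^sup>2 * (1 / \<rho>) ^ (2 * n)"
    by (simp add: \<delta>_def power_mult_distrib power_divide power_mult[symmetric] mult.commute)
  then have "ln (5 / (\<delta> n)\<^sup>2) = ln (5 / \<kappa>\<^sup>2) + ln ((1 / \<rho>) ^ (2 * n))"
    using \<kappa>0 \<rho>_pos ln_mult_pos[of "5 / \<kappa>\<^sup>2" "(1 / \<rho>) ^ (2 * n)"] by (simp only:) simp
  also have "ln ((1 / \<rho>) ^ (2 * n)) = b * n"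
    using \<rho>_pos by (subst ln_realpow) (auto simp: b_def)
  finally have ln_eq: "ln (5 / (\<delta> n)\<^sup>2) = a + b * n" by (simp add: a_def)
  have pw: "(6 * \<delta> n) powr p = e * \<sigma> ^ n"
  proof -
    have "(\<rho> ^ n) powr p = \<sigma> ^ n"
      using \<rho>_pos by (simp add: \<sigma>_def powr_realpow[symmetric] powr_powr mult.commute)
    then show ?thesis using \<kappa>0 \<rho>_pos
      by (simp add: \<delta>_def e_def powr_mult mult.assoc[symmetric])
  qed
  have "real (N n) \<le> ln (5 / (\<delta> n)\<^sup>2) / \<beta> n + 1"
    using ln0 \<beta>0[of n] by (simp add: N_def)
  then have "real (N n) * (6 * \<delta> n) powr p \<le> ((a + b * n) / \<beta> n + 1) * (e * \<sigma> ^ n)"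
    unfolding ln_eq pw[symmetric] by (intro mult_right_mono) auto
  also have "\<dots> = (a + b * n) * (e * \<sigma> ^ n / \<beta> n) + e * \<sigma> ^ n"
    by (simp add: distrib_right)
  also have "e * \<sigma> ^ n / \<beta> n = c * \<theta> ^ n"
  proof -
    have "\<beta> n = \<kappa> / 3 * (2 * \<rho>) ^ n" by (simp add: \<beta>_def \<delta>_def power_mult_distrib)
    moreover have "\<theta> ^ n = \<sigma> ^ n / (2 * \<rho>) ^ n" by (simp add: \<theta>_def \<sigma>_def power_divide)
    ultimately show ?thesis by (simp only: c_def e_def) simp
  qed
  also have "(a + b * n) * (c * \<theta> ^ n) + e * \<sigma> ^ n = F n"
    by (simp add: F_def algebra_simps)
  finally have small: "real (N n) * (2 * (3 * \<delta> n)) powr p < \<eta>" using Fn by simp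
  have "ln (5 / (\<delta> n)\<^sup>2) / \<beta> n \<le> real (N n)"
    unfolding N_def by (rule real_nat_ceiling_ge)
  then obtain x where
    "\<forall>l\<in>{L..1}. \<forall>t\<in>{0..1}. \<exists>k<N n. \<exists>y\<in>C. \<bar>l * y + t - x k\<bar> < 3 * \<delta> n"
    using hitting_points_at_scale[OF L \<delta>_def[of n, unfolded \<kappa>_def] \<beta>_def[of n]] by blast
  moreover have "0 < 3 * \<delta> n" using \<delta>0[of n] by simp
  ultimately show ?thesis using small by blast
qed

end

subsection \<open>Deleting small intervals from the unit interval\<close>

text \<open>Equality of \<open>lo n\<close> and \<open>hi n\<close> is allowed, so that finite
  families can be padded. The bound 1 on the sum serves twice: some of \<open>{0..1}\<close>
  survives, and the gap sum is finite.\<close>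

locale small_intervals =
  fixes lo hi :: "nat \<Rightarrow> real" and p :: real
  assumes lo_le_hi: "lo n \<le> hi n" and p_pos: "0 < p" and p_less: "p < 1"
    and sum_less_1: "(\<Sum>n. ennreal ((hi n - lo n) powr p)) < 1"
begin

definition residual :: "real set" where
  "residual = {0..1} - (\<Union>n. {lo n<..<hi n})"

text \<open>The complement of the support of Lebesgue measure on \<open>residual\<close>; thus
  \<open>core\<close> is this support.\<close>

definition null_open :: "real set" where
  "null_open = \<Union>{B. open B \<and> emeasure lborel (residual \<inter> B) = 0}"

definition core :: "real set" where
  "core = residual - null_open"

lemma closed_residual: "closed residual"
  unfolding residual_def by (intro closed_Diff open_UN) auto

lemma open_null_open: "open null_open"
  unfolding null_open_def by blast

lemma compact_core: "compact core"
proof -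
  have "bounded core" by (rule bounded_subset[of "{0..1}"]) (auto simp: core_def residual_def)
  then show ?thesis
    unfolding compact_eq_bounded_closed core_def
    using closed_residual open_null_open by (simp add: closed_Diff)
qed

text \<open>By the Lindelof property countably many of the open sets suffice for the union.\<close>

lemma null_residual_null_open: "emeasure lborel (residual \<inter> null_open) = 0"
proof -
  let ?F = "{B. open B \<and> emeasure lborel (residual \<inter> B) = 0}"
  obtain F' where F': "F' \<subseteq> ?F" "countable F'" "\<Union>F' = \<Union>?F"
    using Lindelof[of ?F] by blast
  have "(\<Union>B\<in>F'. residual \<inter> B) \<in> null_sets lborel"
    using F'(1) closed_residual by (intro null_sets_UN' F'(2)) (auto simp: null_sets_def)
  moreover have "(\<Union>B\<in>F'. residual \<inter> B) = residual \<inter> null_open"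
    using F'(3) unfolding null_open_def by blast
  ultimately show ?thesis by (metis null_setsD1)
qed

lemma emeasure_core: 
  assumes "B \<in> sets borel"
  shows "emeasure lborel (core \<inter> B) = emeasure lborel (residual \<inter> B)"
proof -
  have meas: "residual \<in> sets borel" "null_open \<in> sets borel" "core \<in> sets borel"
    using closed_residual open_null_open compact_core by (auto intro: borel_compact)
  have "emeasure lborel (residual \<inter> B) \<le> emeasure lborel ((core \<inter> B) \<union> (residual \<inter> null_open))"
    using meas assms by (intro emeasure_mono) (auto simp: core_def)
  also have "\<dots> \<le> emeasure lborel (core \<inter> B) + emeasure lborel (residual \<inter> null_open)"
    using meas assms by (intro emeasure_subadditive) auto
  finally have "emeasure lborel (residual \<inter> B) \<le> emeasure lborel (core \<inter> B)"
    using null_residual_null_open by simp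
  moreover have "emeasure lborel (core \<inter> B) \<le> emeasure lborel (residual \<inter> B)"
    using meas assms by (intro emeasure_mono) (auto simp: core_def)
  ultimately show ?thesis by (rule antisym[rotated])
qed

text \<open>A single term of the sum is less than 1, so the length is at most 1, where the power
  \<open>p < 1\<close> dominates the identity.\<close>

lemma length_le_powr: "hi n - lo n \<le> (hi n - lo n) powr p"
proof -
  have "ennreal ((hi n - lo n) powr p) = (\<Sum>i\<in>{n}. ennreal ((hi i - lo i) powr p))" by simp
  also have "\<dots> \<le> (\<Sum>n. ennreal ((hi n - lo n) powr p))" by (intro sum_le_suminf) auto
  also have "\<dots> < 1" by (rule sum_less_1)
  finally have less1: "(hi n - lo n) powr p < 1" by simp
  have "hi n - lo n \<le> 1"
  proof (rule ccontr)
    assume "\<not> hi n - lo n \<le> 1"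
    then have "1 \<le> (hi n - lo n) powr p" using p_pos by (intro ge_one_powr_ge_zero) auto
    then show False using less1 by simp
  qed
  then show ?thesis
    using powr_mono'[of p 1 "hi n - lo n"] lo_le_hi[of n] p_less by simp
qed

lemma emeasure_core_pos: "0 < emeasure lborel core"
proof -
  let ?V = "\<Union>n. {lo n<..<hi n}"
  have meas: "residual \<in> sets borel" using closed_residual by auto
  have "emeasure lborel ?V \<le> (\<Sum>n. emeasure lborel {lo n<..<hi n})"
    by (intro emeasure_subadditive_countably) auto
  also have "\<dots> \<le> (\<Sum>n. ennreal ((hi n - lo n) powr p))"
    using lo_le_hi length_le_powr by (intro suminf_le) (auto intro!: ennreal_leI)
  also have "\<dots> < 1" by (rule sum_less_1)
  finally have V: "emeasure lborel ?V < 1" .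
  have "1 = emeasure lborel {0..1::real}" by simp
  also have "\<dots> \<le> emeasure lborel (residual \<union> ?V)"
    using meas by (intro emeasure_mono) (auto simp: residual_def)
  also have "\<dots> \<le> emeasure lborel residual + emeasure lborel ?V"
    using meas by (intro emeasure_subadditive) auto
  finally have "emeasure lborel residual \<noteq> 0" using V by (auto simp: not_less)
  then show ?thesis using emeasure_core[of UNIV] by (simp add: zero_less_iff_neq_zero)
qed

text \<open>A ball with finitely many points of \<open>core\<close> would be null for
  \<open>residual\<close> and hence part of \<open>null_open\<close>.\<close>

lemma core_islimpt:
  assumes "x \<in> core" shows "x islimpt core"
  unfolding islimpt_eq_infinite_ball
proof (intro allI impI notI)
  fix e :: real assume "0 < e" and fin: "finite (core \<inter> ball x e)"
  have "emeasure lborel (residual \<inter> ball x e) = emeasure lborel (core \<inter> ball x e)"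
    by (simp add: emeasure_core)
  also have "\<dots> = 0" using fin by (intro emeasure_lborel_countable countable_finite)
  finally have "ball x e \<subseteq> null_open" unfolding null_open_def by auto
  then have "x \<in> null_open" using \<open>0 < e\<close> by auto
  then show False using assms by (simp add: core_def)
qed

lemma cantor_set_core:
  assumes "\<And>a b. a < b \<Longrightarrow> \<not> {a..b} \<subseteq> residual"
  shows "cantor_set core"
proof (rule cantor_setI)
  show "core \<noteq> {}" using emeasure_core_pos by auto
  show "\<not> {a..b} \<subseteq> core" if "a < b" for a b
    using assms[OF that] unfolding core_def by blast
qed (use compact_core core_islimpt in auto)

definition meets :: "real \<times> real \<Rightarrow> nat \<Rightarrow> bool" where
  "meets g n \<longleftrightarrow> {lo n<..<hi n} \<inter> {fst g<..<snd g} \<noteq> {}"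

text \<open>A gap misses \<open>core\<close>, so \<open>residual\<close> is null in it, and its
  length is at most the total length of the deleted intervals meeting it; subadditivity of the
  \<open>p\<close>-th power does the rest.\<close>

lemma gap_powr_le:
  assumes g: "(a, b) \<in> gaps core"
  shows "ennreal ((b - a) powr p) \<le> (\<Sum>n. ennreal ((hi n - lo n) powr p) * of_bool (meets (a, b) n))"
proof -
  define w where "w n = (hi n - lo n) powr p * of_bool (meets (a, b) n)" for n
  have ab: "a < b" and comp: "{a<..<b} \<in> components (convex hull core - core)"
    using g by (auto simp: gaps_def)
  have sub: "{a<..<b} \<subseteq> convex hull core - core" using in_components_subset[OF comp] .
  have "convex hull core \<subseteq> {0..1}"
    by (intro hull_minimal) (auto simp: core_def residual_def)
  then have unit: "{a<..<b} \<subseteq> {0..1}" using sub by blast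
  have w0: "0 \<le> w n" for n by (simp add: w_def)
  have "(\<Sum>n. ennreal (w n)) \<le> (\<Sum>n. ennreal ((hi n - lo n) powr p))"
    by (intro suminf_le) (auto simp: w_def)
  then have "(\<Sum>n. ennreal (w n)) \<noteq> top"
    using sum_less_1 by (metis leD ennreal_one_less_top less_trans top.not_eq_extremum)
  then have summ: "summable w" by (intro summable_suminf_not_top w0)
  define s where "s = suminf w"
  have s0: "0 \<le> s" unfolding s_def by (intro suminf_nonneg summ w0)
  txt \<open>Comparing each term with the total \<open>s\<close> gives subadditivity of \<open>x \<mapsto> x^p\<close> in the form
    \<open>(\<Sum> len) \<le> s^(1/p)\<close>.\<close>
  have len: "(hi n - lo n) * of_bool (meets (a, b) n) \<le> w n * s powr (1/p - 1)" for n
  proof (cases "meets (a, b) n \<and> lo n < hi n")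
    case True
    then have wn: "w n = (hi n - lo n) powr p" "0 < w n" by (auto simp: w_def)
    have "w n \<le> s" using sum_le_suminf[OF summ, of "{n}"] w0 by (simp add: s_def)
    then have "w n powr (1/p - 1) \<le> s powr (1/p - 1)"
      using p_pos p_less wn by (intro powr_mono2) auto
    then have "w n * w n powr (1/p - 1) \<le> w n * s powr (1/p - 1)"
      using w0 by (intro mult_left_mono) auto
    moreover have "w n * w n powr (1/p - 1) = w n powr (1/p)"
      using powr_mult_base[of "w n" "1/p - 1"] w0 by simp
    moreover have "w n powr (1/p) = hi n - lo n"
      using True wn p_pos by (simp add: powr_powr)
    ultimately show ?thesis using True by simp
  next
    case False
    then show ?thesis using lo_le_hi[of n] w0[of n] by (auto simp: not_less)
  qed
  have meas: "residual \<in> sets borel" using closed_residual by auto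
  have null: "emeasure lborel (residual \<inter> {a<..<b}) = 0"
  proof -
    have "core \<inter> {a<..<b} = {}" using sub by blast
    then show ?thesis using emeasure_core[of "{a<..<b}"] by simp
  qed
  have "ennreal (b - a) = emeasure lborel {a<..<b}" using ab by simp
  also have "\<dots> \<le> emeasure lborel ((residual \<inter> {a<..<b}) \<union> (\<Union>n. {lo n<..<hi n} \<inter> {a<..<b}))"
    using meas unit by (intro emeasure_mono) (auto simp: residual_def)
  also have "\<dots> \<le> emeasure lborel (residual \<inter> {a<..<b}) + emeasure lborel (\<Union>n. {lo n<..<hi n} \<inter> {a<..<b})"
    using meas by (intro emeasure_subadditive) auto
  also have "\<dots> = emeasure lborel (\<Union>n. {lo n<..<hi n} \<inter> {a<..<b})" using null by simp
  also have "\<dots> \<le> (\<Sum>n. emeasure lborel ({lo n<..<hi n} \<inter> {a<..<b}))"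
    by (intro emeasure_subadditive_countably) auto
  also have "\<dots> \<le> (\<Sum>n. ennreal (w n * s powr (1/p - 1)))"
  proof (intro suminf_le)
    fix n
    have "emeasure lborel ({lo n<..<hi n} \<inter> {a<..<b}) \<le> ennreal ((hi n - lo n) * of_bool (meets (a, b) n))"
    proof (cases "meets (a, b) n")
      case True
      have "emeasure lborel ({lo n<..<hi n} \<inter> {a<..<b}) \<le> emeasure lborel {lo n<..<hi n}"
        by (intro emeasure_mono) auto
      then show ?thesis using True lo_le_hi[of n] by simp
    qed (simp add: meets_def)
    also have "\<dots> \<le> ennreal (w n * s powr (1/p - 1))" using len by (intro ennreal_leI)
    finally show "emeasure lborel ({lo n<..<hi n} \<inter> {a<..<b}) \<le> ennreal (w n * s powr (1/p - 1))" .
  qed auto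
  also have "\<dots> = ennreal (s * s powr (1/p - 1))"
    unfolding s_def using summ w0
    by (subst suminf_ennreal2) (auto simp: suminf_mult2[symmetric] intro: summable_mult2)
  also have "s * s powr (1/p - 1) = s powr (1/p)"
    using powr_mult_base[OF s0, of "1/p - 1"] by simp
  finally have "b - a \<le> s powr (1/p)" by simp
  then have "(b - a) powr p \<le> (s powr (1/p)) powr p" using ab p_pos by (intro powr_mono2) auto
  also have "\<dots> = s" using s0 p_pos by (simp add: powr_powr)
  finally have "ennreal ((b - a) powr p) \<le> ennreal s" by (rule ennreal_leI)
  also have "\<dots> = (\<Sum>n. ennreal (w n))" unfolding s_def by (intro suminf_ennreal2[symmetric] w0 summ)
  also have "\<dots> = (\<Sum>n. ennreal ((hi n - lo n) powr p) * of_bool (meets (a, b) n))"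
    by (intro suminf_cong) (auto simp: w_def)
  finally show ?thesis .
qed

text \<open>Within the hull a deleted interval is a connected set disjoint from \<open>core\<close>,
  so it lies in one component of the complement.\<close>

lemma meets_unique:
  assumes "g \<in> gaps core" "h \<in> gaps core" "meets g n" "meets h n"
  shows "g = h"
proof -
  \<comment> \<open>A deleted interval may stick out of the hull; its trace on the hull is still
    convex.\<close>
  let ?J = "{lo n<..<hi n} \<inter> convex hull core"
  have J: "connected ?J" "?J \<subseteq> convex hull core - core"
    by (auto intro!: convex_connected convex_Int simp: core_def residual_def)
  have comp: "{fst q<..<snd q} \<in> components (convex hull core - core)" "fst q < snd q"
    if "q \<in> gaps core" for q
    using that by (auto simp: gaps_def)
  have sub: "?J \<subseteq> {fst q<..<snd q} \<and> ?J \<noteq> {}" if q: "q \<in> gaps core" "meets q n" for q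
  proof -
    have "{fst q<..<snd q} \<subseteq> convex hull core"
      using in_components_subset[OF comp(1)] q by blast
    then have "{fst q<..<snd q} \<inter> ?J \<noteq> {}" using q unfolding meets_def by blast
    then show ?thesis using components_maximal[OF comp(1) J] q by blast
  qed
  have "{fst g<..<snd g} \<inter> {fst h<..<snd h} \<noteq> {}" using sub assms by blast
  then have eq: "{fst g<..<snd g} = {fst h<..<snd h}"
    using components_nonoverlap[OF comp(1) comp(1)] assms by blast
  have "fst q = Inf {fst q<..<snd q}" "snd q = Sup {fst q<..<snd q}" if "q \<in> gaps core" for q
    using comp(2)[OF that] by simp_all
  then have "fst g = fst h" "snd g = snd h" using eq assms by metis+
  then show ?thesis by (rule prod_eqI)
qed

text \<open>After exchanging the sums, each deleted interval is charged to at most one gap, so every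
  finite partial sum is at most 1.\<close>

lemma gap_condition_core: "gap_condition p core"
proof -
  let ?f = "\<lambda>(a, b). (b - a) powr p"
  have bound: "sum ?f F \<le> 1" if F: "finite F" "F \<subseteq> gaps core" for F
  proof -
    have "ennreal (sum ?f F) = (\<Sum>g\<in>F. ennreal (?f g))" by (simp add: sum_ennreal case_prod_unfold)
    also have "\<dots> \<le> (\<Sum>g\<in>F. \<Sum>n. ennreal ((hi n - lo n) powr p) * of_bool (meets g n))"
      using F gap_powr_le by (intro sum_mono) auto
    also have "\<dots> = (\<Sum>n. \<Sum>g\<in>F. ennreal ((hi n - lo n) powr p) * of_bool (meets g n))"
      by (intro suminf_sum[symmetric]) auto
    also have "\<dots> \<le> (\<Sum>n. ennreal ((hi n - lo n) powr p))"
    proof (intro suminf_le)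
      fix n
      have "\<forall>g\<in>F \<inter> Collect (\<lambda>g. meets g n). \<forall>h\<in>F \<inter> Collect (\<lambda>g. meets g n). g = h"
        using F(2) meets_unique by blast
      then have "card (F \<inter> Collect (\<lambda>g. meets g n)) \<le> Suc 0"
        using F(1) by (subst card_le_Suc0_iff_eq) auto
      then have "(\<Sum>g\<in>F. of_bool (meets g n)) \<le> (1::ennreal)"
        using F(1) by (simp add: sum_of_bool_eq)
      then show "(\<Sum>g\<in>F. ennreal ((hi n - lo n) powr p) * of_bool (meets g n))
          \<le> ennreal ((hi n - lo n) powr p)"
        unfolding sum_distrib_left[symmetric] using mult_left_mono by fastforce
    qed auto
    also have "\<dots> \<le> 1" using sum_less_1 by simp
    finally show ?thesis by simp
  qed
  have "?f summable_on gaps core"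
    using bound by (intro nonneg_bdd_above_summable_on bdd_aboveI[of _ 1]) auto
  then show ?thesis unfolding gap_condition_def using compact_core by blast
qed

end

section \<open>Choice of the ratio, and deletion for all scales at once\<close>

theorem proposition4p3:
  fixes d p :: real
  assumes "0 < d" and "d < 1" and "1 - d < p" and "p < 1"
  shows "\<exists>K Kt :: real set.
           regular_cantor_set K \<and> hausdorff_dim K = ennreal d \<and>
           cantor_set Kt \<and> emeasure lborel Kt > 0 \<and> gap_condition p Kt \<and>
           (\<forall>l>0. \<forall>t. \<not> (\<lambda>x. l * x + t) ` K \<subseteq> Kt)"
proof -
  define \<rho> where "\<rho> = (1/2::real) powr (1/d)"
  have \<rho>_pos: "0 < \<rho>" by (simp add: \<rho>_def)
  have "\<rho> < (1/2) powr 1"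
    unfolding \<rho>_def using assms(1,2) by (intro powr_less_mono') (auto simp: field_simps)
  then interpret cantor_ratio \<rho> using \<rho>_pos by unfold_locales auto
  have \<rho>_d: "\<rho> powr d = 1/2" using assms by (simp add: \<rho>_def powr_powr)
  \<comment> \<open>Here \<open>p > 1 - d\<close> enters: since \<open>\<rho> powr d = 1/2\<close>,
    the right-hand side equals \<open>2 * \<rho>\<close>.\<close>
  have "\<rho> powr p < \<rho> powr (1 - d)"
    using assms \<rho>_pos \<rho>_less by (intro powr_less_mono') auto
  also have "\<dots> = 2 * \<rho>" using \<rho>_pos by (simp add: powr_diff \<rho>_d)
  finally have \<rho>_p: "\<rho> powr p < 2 * \<rho>" .
  have p_pos: "0 < p" using assms by linarith
  \<comment> \<open>Family \<open>m\<close> handles the scales from \<open>1 / (m + 1)\<close> to 1;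
    the budgets \<open>(1/2) ^ (m + 2)\<close> add up to 1/2.\<close>
  have "\<exists>x N \<epsilon>. 0 < \<epsilon> \<and> real N * (2 * \<epsilon>) powr p < (1/2) ^ (m + 2) \<and>
      (\<forall>l\<in>{1 / real (Suc m)..1}. \<forall>t\<in>{0..1}. \<exists>k<N. \<exists>y\<in>C. \<bar>l * y + t - x k\<bar> < \<epsilon>)" for m
    by (rule hitting_points[OF p_pos \<rho>_p]) auto
  then obtain x N \<epsilon> where \<epsilon>: "\<And>m. 0 < \<epsilon> m"
    and small: "\<And>m. real (N m) * (2 * \<epsilon> m) powr p < (1/2) ^ (m + 2)"
    and hit: "\<And>m l t. l \<in> {1 / real (Suc m)..1} \<Longrightarrow> t \<in> {0..1} \<Longrightarrow>
      \<exists>k<N m. \<exists>y\<in>C. \<bar>l * y + t - x m k\<bar> < \<epsilon> m"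
    by metis
  \<comment> \<open>Indices beyond \<open>N m\<close> get radius 0, that is, an empty open interval
    contributing \<open>0 powr p = 0\<close>.\<close>
  define r where "r = (\<lambda>(m, k). if k < N m then \<epsilon> m else 0)"
  define lo where "lo n = case_prod x (prod_decode n) - r (prod_decode n)" for n
  define hi where "hi n = case_prod x (prod_decode n) + r (prod_decode n)" for n
  have r0: "0 \<le> r mk" for mk using \<epsilon> by (auto simp: r_def less_imp_le split: prod.split)
  have "(\<Sum>n. ennreal ((hi n - lo n) powr p)) = (\<Sum>n. ennreal ((2 * r (prod_decode n)) powr p))"
    by (simp add: hi_def lo_def)
  also have "\<dots> = (\<Sum>m. \<Sum>k. ennreal ((2 * r (m, k)) powr p))"
    by (rule suminf_ennreal_2dimen) simp
  also have "\<dots> \<le> (\<Sum>m. ennreal ((1/2) ^ (m + 2)))"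
  proof (intro suminf_le)
    fix m
    have "(\<Sum>k. ennreal ((2 * r (m, k)) powr p)) = (\<Sum>k<N m. ennreal ((2 * r (m, k)) powr p))"
      by (intro suminf_finite) (auto simp: r_def)
    also have "\<dots> = (\<Sum>k<N m. ennreal ((2 * \<epsilon> m) powr p))"
      by (intro sum.cong) (auto simp: r_def)
    also have "\<dots> = ennreal (real (N m) * (2 * \<epsilon> m) powr p)"
      by (simp add: ennreal_mult ennreal_of_nat_eq_real_of_nat)
    also have "\<dots> \<le> ennreal ((1/2) ^ (m + 2))" using small by (intro ennreal_leI less_imp_le)
    finally show "(\<Sum>k. ennreal ((2 * r (m, k)) powr p)) \<le> ennreal ((1/2) ^ (m + 2))" .
  qed auto
  also have "\<dots> = ennreal (1/2)"
  proof -
    have "(\<lambda>m. (1/4) * (1/2::real) ^ m) sums ((1/4) * (1 / (1 - 1/2)))"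
      by (intro sums_mult geometric_sums) simp
    then have "(\<lambda>m. (1/2::real) ^ (m + 2)) sums (1/2)" by simp
    then show ?thesis by (intro suminf_ennreal_eq) auto
  qed
  also have "\<dots> < ennreal 1" by (rule ennreal_lessI) auto
  also have "\<dots> = 1" by simp
  finally interpret small_intervals lo hi p
    using r0 p_pos assms(4) by unfold_locales (auto simp: lo_def hi_def)
  have avoid: "\<not> (\<lambda>x. l * x + t) ` C \<subseteq> residual" if "0 < l" for l t
  proof
    assume sub: "(\<lambda>x. l * x + t) ` C \<subseteq> residual"
    \<comment> \<open>As 0 and 1 belong to \<open>C\<close>, a copy inside \<open>{0..1}\<close> has
      \<open>t\<close> in \<open>{0..1}\<close> and \<open>l \<le> 1\<close>, the range treated by
      \<open>hit\<close>.\<close>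
    have "l * 0 + t \<in> residual" "l * 1 + t \<in> residual"
      using sub zero_in_C one_in_C by blast+
    then have t: "t \<in> {0..1}" and "l \<le> 1" by (auto simp: residual_def)
    obtain m where "inverse (real (Suc m)) < l" using reals_Archimedean[OF \<open>0 < l\<close>] by blast
    then have "l \<in> {1 / real (Suc m)..1}" using \<open>l \<le> 1\<close> by (simp add: inverse_eq_divide)
    then obtain k y where ky: "k < N m" "y \<in> C" "\<bar>l * y + t - x m k\<bar> < \<epsilon> m"
      using hit t by blast
    then have "l * y + t \<in> {lo (prod_encode (m, k))<..<hi (prod_encode (m, k))}"
      by (auto simp: lo_def hi_def r_def)
    then have "l * y + t \<notin> residual" unfolding residual_def by blast
    then show False using sub ky by blast
  qed
  \<comment> \<open>Every nondegenerate interval contains an affine copy of \<open>C\<close>, so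
    avoiding the copies also rules out intervals.\<close>
  have "\<not> {a..b} \<subseteq> residual" if "a < b" for a b
  proof
    assume ab: "{a..b} \<subseteq> residual"
    have "(\<lambda>x. (b - a) * x + a) ` C \<subseteq> {a..b}"
    proof (intro image_subsetI)
      fix y assume "y \<in> C"
      then have "0 \<le> y" "y \<le> 1" using C_unit by auto
      then have "0 \<le> (b - a) * y" "(b - a) * y \<le> b - a"
        using \<open>a < b\<close> by (auto simp: mult_left_le)
      then show "(b - a) * y + a \<in> {a..b}" by simp
    qed
    then show False using avoid[of "b - a" a] ab \<open>a < b\<close> by auto
  qed
  then have "cantor_set core" by (rule cantor_set_core)
  moreover have "\<not> (\<lambda>x. l * x + t) ` C \<subseteq> core" if "0 < l" for l t
    using avoid[OF that, of t] unfolding core_def by blast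
  ultimately show ?thesis
    using regular_cantor_set_C hausdorff_dim_C[OF assms(1) \<rho>_d] emeasure_core_pos gap_condition_core
    by blast
qed

end
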